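(* Let $w$ be a finite prime of $F$, $K$ the completion of $F$ at $w$, and $\phi$ a rank $r$ Drinfeld $A$-module over $K$ with stable reduction whose reduction has rank $r'$, $1\le r'<r$, with Tate uniformization $(\psi,\Lambda,e_\phi)$. Let $u$ be a finite prime of $A$ and $n$ a positive integer. Let $\{\omega_i\}_{i=1,\ldots,r'}$ be an SMB of $\psi[u^n]$, let $\{\omega_i^0\}_{i=r'+1,\ldots,r}$ be an SMB of $\Lambda$, and for $i=r'+1,\ldots,r$ let $\omega_i$ be a root of $\psi_{u^n}(X)-\omega_i^0$. Then $\{e_\phi(\omega_i)\}_{i=1,\ldots,r}$ is an SMB of $\phi[u^n]$.
   Context: $q$ a power of a prime $p$, $A=\mathbb{F}_q[t]$, $F$ a finite extension of $\mathbb{F}_q(t)$; a finite prime of $F$ is one not lying over $1/t$. $K$ is the completion at $w$, $w$ its normalized valuation ($w(K^\times)=\mathbb{Z}$) extended to $K^{\mathrm{sep}}$ and to the completion $\mathbb{C}_w$ of an algebraic closure. A rank $r$ Drinfeld module over $K$: $\phi_t(X)=tX+a_1X^q+\cdots+a_rX^{q^r}$, $a_r\ne0$; $a\cdot_\phi x=\phi_a(x)$. $\phi$ has stable reduction with reduction of rank $r'$ if all $a_i$ lie in the valuation ring, $a_{r'}$ is a unit and $w(a_i)>0$ for $i>r'$; good reduction means $r'=r$. For a Drinfeld module $\rho$ of rank $s$ and a monic irreducible $u\in A$, $\rho[u^n]$ is the $A/u^n$-module of roots of $\rho_{u^n}(X)$ in $K^{\mathrm{sep}}$, and an SMB of $\rho[u^n]$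 is a family $\{\lambda_i\}_{i=1}^s\subset\rho[u^n]$ such that for each $i$, $\lambda_1,\dots,\lambda_i$ are $A/u^n$-linearly independent and $w(\lambda_i)$ is largest among $w(\lambda)$, $\lambda\in\rho[u^n]$ with $\lambda_1,\dots,\lambda_{i-1},\lambda$ $A/u^n$-linearly independent. Tate uniformization: a rank $r'$ Drinfeld module $\psi$ over $K$ with good reduction, an $A$-lattice $\Lambda\subset\mathbb{C}_w$ of rank $r-r'$ for the action $a\cdot_\psi z=\psi_a(z)$, stable under $\mathrm{Gal}(K^{\mathrm{sep}}/K)$, all of whose nonzero elements have negative valuation, and the surjective entire map $e_\phi(z)=z\prod_{\mu\in\Lambda\setminus\{0\}}(1-z/\mu)$ with kernel $\Lambda$ and $e_\phi(\psi_a(z))=\phi_a(e_\phi(z))$. Define $|x|=(-w(x))^{1/r'}$ if $w(x)<0$, $|x|=-(w(x))^{1/r'}$ if $w(x)\ge0$, $|0|=-\infty$. An SMB of $\Lambda$ is a family $\{\omega_i^0\}_{i=r'+1}^r\subset\Lambda$ such that for each $i$, $\omega^0_{r'+1},\dots,\omega^0_i$ are $A$-linearly independent (for $\cdot_\psi$) and $|\omega^0_i|$ is minimal among $|\omega|$, $\omega\in\Lambda$ with $\omega^0_{r'+1},\dots,\omega^0_{i-1},\omega$ $A$-linearly independent. *)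

theory Defs
  imports "HOL-Analysis.Analysis" "HOL-Computational_Algebra.Computational_Algebra"
begin

text \<open>
  The type \<open>'k\<close> is the finite field with \<open>q = CARD('k)\<close> elements, \<open>'k poly\<close> is \<open>A\<close> and
  \<open>'k poly fract\<close> is its fraction field. All other fields are subfields of one algebraically
  closed field \<open>'c\<close>, which plays the role of the completed algebraic closure; the fraction field
  of \<open>A\<close> is embedded into it by a field homomorphism \<open>h\<close>.
\<close>

section \<open>Valued fields\<close>

definition is_subfield :: "'c::field set \<Rightarrow> bool" where
  "is_subfield S \<longleftrightarrow> 0 \<in> S \<and> 1 \<in> S \<and>
     (\<forall>x\<in>S. \<forall>y\<in>S. x + y \<in> S \<and> x * y \<in> S) \<and> (\<forall>x\<in>S. - x \<in> S \<and> inverse x \<in> S)"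

definition is_field_hom :: "('a::field \<Rightarrow> 'b::field) \<Rightarrow> bool" where
  "is_field_hom f \<longleftrightarrow> f 1 = 1 \<and> (\<forall>x y. f (x + y) = f x + f y \<and> f (x * y) = f x * f y)"

definition is_valuation :: "('c::field \<Rightarrow> ereal) \<Rightarrow> bool" where
  "is_valuation w \<longleftrightarrow>
     (\<forall>x. w x \<noteq> - \<infinity>) \<and> (\<forall>x. w x = \<infinity> \<longleftrightarrow> x = 0) \<and>
     (\<forall>x y. w (x * y) = w x + w y) \<and> (\<forall>x y. min (w x) (w y) \<le> w (x + y))"

definition val_dist :: "('c::field \<Rightarrow> ereal) \<Rightarrow> 'c \<Rightarrow> 'c \<Rightarrow> real" where
  "val_dist w x y = (if x = y then 0 else 2 powr (- real_of_ereal (w (x - y))))"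

lemma Metric_space_val_dist:
  assumes "is_valuation w"
  shows "Metric_space UNIV (val_dist w)"
proof -
  have mult: "w (x * y) = w x + w y" and ninf: "w x \<noteq> - \<infinity>"
    and inf: "w x = \<infinity> \<longleftrightarrow> x = 0" and ultra: "min (w x) (w y) \<le> w (x + y)" for x y
    using assms by (auto simp: is_valuation_def)
  have fin: "\<exists>r. w x = ereal r" if "x \<noteq> 0" for x
    using ninf[of x] inf[of x] that by (cases "w x") auto
  obtain a where a: "w 1 = ereal a" using fin[of 1] by auto
  obtain b where b: "w (-1) = ereal b" using fin[of "-1"] by auto
  have "a = 0" using mult[of 1 1] a by simp
  then have "b = 0" using mult[of "-1" "-1"] a b by simp
  then have neg: "w (- x) = w x" for x
    using mult[of "-1" x] b by (simp flip: zero_ereal_def)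
  have sym: "val_dist w x y = val_dist w y x" for x y
    using neg[of "x - y"] by (auto simp: val_dist_def)
  have nonneg: "0 \<le> val_dist w x y" for x y
    by (simp add: val_dist_def)
  have tri: "val_dist w x z \<le> val_dist w x y + val_dist w y z" for x y z
  proof (cases "x = y \<or> y = z \<or> x = z")
    case True
    then show ?thesis using nonneg[of x y] nonneg[of y z] by (auto simp: val_dist_def)
  next
    case False
    then obtain r s m where
      e: "w (x - y) = ereal r" "w (y - z) = ereal s" "w (x - z) = ereal m"
      using fin[of "x - y"] fin[of "y - z"] fin[of "x - z"] by auto
    then have "min r s \<le> m"
      using ultra[of "x - y" "y - z"] by (simp add: min_def split: if_splits)
    then have "2 powr (- m) \<le> 2 powr (- r) \<or> 2 powr (- m) \<le> 2 powr (- s)"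
      by (auto simp: min_def split: if_splits)
    moreover have "0 < 2 powr (- r)" "0 < 2 powr (- s)" by auto
    ultimately have "2 powr (- m) \<le> 2 powr (- r) + 2 powr (- s)" by linarith
    then show ?thesis using False e by (simp add: val_dist_def)
  qed
  have zero: "val_dist w x y = 0 \<longleftrightarrow> x = y" for x y
    by (simp add: val_dist_def)
  show ?thesis
    by unfold_locales (rule nonneg sym zero tri)+
qed

abbreviation val_top :: "('c::field \<Rightarrow> ereal) \<Rightarrow> 'c topology" where
  "val_top w \<equiv> Metric_space.mtopology UNIV (val_dist w)"

definition alg_clos :: "'c::field set \<Rightarrow> 'c set" where
  "alg_clos K = {x. \<exists>p. p \<noteq> 0 \<and> (\<forall>i. coeff p i \<in> K) \<and> poly p x = 0}"

text \<open>Over an algebraically closed \<open>'c\<close>, the condition \<open>rsquarefree p\<close> says that \<open>p\<close> has no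
  multiple root in an algebraic closure, i.e. that \<open>p\<close> is separable.\<close>

definition sep_clos :: "'c::alg_closed_field set \<Rightarrow> 'c set" where
  "sep_clos K = {x. \<exists>p. rsquarefree p \<and> (\<forall>i. coeff p i \<in> K) \<and> poly p x = 0}"

definition galois_group :: "'c::alg_closed_field set \<Rightarrow> ('c \<Rightarrow> 'c) set" where
  "galois_group K = {g. bij_betw g (sep_clos K) (sep_clos K) \<and> (\<forall>x\<in>K. g x = x) \<and>
     (\<forall>x\<in>sep_clos K. \<forall>y\<in>sep_clos K. g (x + y) = g x + g y \<and> g (x * y) = g x * g y)}"

text \<open>The Galois group acts on \<open>'c\<close> through the continuous extensions of its elements.\<close>

definition galois_stable :: "('c::alg_closed_field \<Rightarrow> ereal) \<Rightarrow> 'c set \<Rightarrow> 'c set \<Rightarrow> bool" where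
  "galois_stable w K L \<longleftrightarrow>
     (\<forall>g\<in>galois_group K. \<forall>\<sigma>. continuous_map (val_top w) (val_top w) \<sigma> \<and>
        (\<forall>x\<in>sep_clos K. \<sigma> x = g x) \<longrightarrow> \<sigma> ` L \<subseteq> L)"

definition is_entire :: "('c::field \<Rightarrow> ereal) \<Rightarrow> ('c \<Rightarrow> 'c) \<Rightarrow> bool" where
  "is_entire w f \<longleftrightarrow>
     (\<exists>c. \<forall>z. limitin (val_top w) (\<lambda>N. \<Sum>i<N. c i * z ^ i) (f z) sequentially)"

abbreviation t_elem :: "('k::field poly fract \<Rightarrow> 'c::field) \<Rightarrow> 'c" where
  "t_elem h \<equiv> h (to_fract [:0, 1:])"

text \<open>
  \<open>F\<close> is a finite extension of the rational function field, \<open>w\<close> restricted to \<open>F\<close> is a prime not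
  lying over \<open>1/t\<close>, \<open>K\<close> is the completion of \<open>F\<close> and \<open>'c\<close> is the completion of the
  algebraic closure of \<open>K\<close>, all with valuation \<open>w\<close>.
\<close>

locale completion_at_finite_prime =
  fixes h :: "'k::{field,finite} poly fract \<Rightarrow> 'c::alg_closed_field"
    and w :: "'c \<Rightarrow> ereal"
    and F K :: "'c set"
  assumes hom: "is_field_hom h"
    and subfield: "is_subfield F" and base: "range h \<subseteq> F"
    and finite_ext: "\<exists>B. finite B \<and> F = module.span (\<lambda>c x. h c * x) B"
    and valuation: "is_valuation w"
    and normalized: "w ` (K - {0}) = range (\<lambda>m::int. ereal (of_int m))"
    and finite_prime: "0 \<le> w (t_elem h)"
    and completion: "K = val_top w closure_of F"
    and complete: "Metric_space.mcomplete UNIV (val_dist w)"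
    and alg_dense: "val_top w closure_of alg_clos K = UNIV"

section \<open>Drinfeld modules\<close>

text \<open>A Drinfeld module is represented by its polynomial \<open>\<phi>\<^sub>t(X)\<close>.\<close>

definition drinfeld_module ::
    "('k::{field,finite} poly fract \<Rightarrow> 'c::field) \<Rightarrow> 'c set \<Rightarrow> nat \<Rightarrow> 'c poly \<Rightarrow> bool" where
  "drinfeld_module h K r \<phi> \<longleftrightarrow> 1 \<le> r \<and>
     (\<exists>a. (\<forall>i\<in>{1..r}. a i \<in> K) \<and> a r \<noteq> 0 \<and>
        \<phi> = monom (t_elem h) 1 + (\<Sum>i=1..r. monom (a i) (CARD('k) ^ i)))"

text \<open>\<open>\<phi>\<^sub>a(X)\<close> for \<open>a = \<Sum> c\<^sub>i t\<^sup>i\<close> is \<open>\<Sum> c\<^sub>i \<phi>\<^sub>t\<^sup>i(X)\<close> with compositional powers.\<close>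

definition drinfeld_poly ::
    "('k::field poly fract \<Rightarrow> 'c::field) \<Rightarrow> 'c poly \<Rightarrow> 'k poly \<Rightarrow> 'c poly" where
  "drinfeld_poly h \<phi> a =
     (\<Sum>i\<le>degree a. smult (h (to_fract [:coeff a i:])) ((pcompose \<phi> ^^ i) [:0, 1:]))"

abbreviation drinfeld_act ::
    "('k::field poly fract \<Rightarrow> 'c::field) \<Rightarrow> 'c poly \<Rightarrow> 'k poly \<Rightarrow> 'c \<Rightarrow> 'c" where
  "drinfeld_act h \<phi> a x \<equiv> poly (drinfeld_poly h \<phi> a) x"

definition stable_reduction :: "nat \<Rightarrow> ('c::field \<Rightarrow> ereal) \<Rightarrow> nat \<Rightarrow> 'c poly \<Rightarrow> nat \<Rightarrow> bool" where
  "stable_reduction q w r \<phi> r' \<longleftrightarrow> r' \<le> r \<and>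
     (\<forall>i\<in>{1..r}. 0 \<le> w (coeff \<phi> (q ^ i))) \<and> w (coeff \<phi> (q ^ r')) = 0 \<and>
     (\<forall>i\<in>{1..r}. r' < i \<longrightarrow> 0 < w (coeff \<phi> (q ^ i)))"

definition good_reduction :: "nat \<Rightarrow> ('c::field \<Rightarrow> ereal) \<Rightarrow> nat \<Rightarrow> 'c poly \<Rightarrow> bool" where
  "good_reduction q w r \<phi> \<longleftrightarrow> stable_reduction q w r \<phi> r"

text \<open>Linear independence over \<open>A/m\<close> of a family in a module killed by \<open>m\<close>; for \<open>m = 0\<close> this is
  linear independence over \<open>A\<close>.\<close>

definition lin_indep_mod ::
    "('k::field poly fract \<Rightarrow> 'c::field) \<Rightarrow> 'c poly \<Rightarrow> 'k poly \<Rightarrow> nat set \<Rightarrow> (nat \<Rightarrow> 'c) \<Rightarrow> bool"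
  where
  "lin_indep_mod h \<rho> m I x \<longleftrightarrow>
     (\<forall>a. (\<Sum>i\<in>I. drinfeld_act h \<rho> (a i) (x i)) = 0 \<longrightarrow> (\<forall>i\<in>I. m dvd a i))"

abbreviation lin_indep ::
    "('k::field poly fract \<Rightarrow> 'c::field) \<Rightarrow> 'c poly \<Rightarrow> nat set \<Rightarrow> (nat \<Rightarrow> 'c) \<Rightarrow> bool" where
  "lin_indep h \<rho> I x \<equiv> lin_indep_mod h \<rho> 0 I x"

definition torsion ::
    "('k::field poly fract \<Rightarrow> 'c::alg_closed_field) \<Rightarrow> 'c set \<Rightarrow> 'c poly \<Rightarrow> 'k poly \<Rightarrow> 'c set" where
  "torsion h K \<rho> m = {x \<in> sep_clos K. drinfeld_act h \<rho> m x = 0}"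

definition torsion_SMB ::
    "('k::field poly fract \<Rightarrow> 'c::alg_closed_field) \<Rightarrow> ('c \<Rightarrow> ereal) \<Rightarrow> 'c set \<Rightarrow> nat \<Rightarrow> 'c poly
     \<Rightarrow> 'k poly \<Rightarrow> (nat \<Rightarrow> 'c) \<Rightarrow> bool" where
  "torsion_SMB h w K s \<rho> m x \<longleftrightarrow>
     (\<forall>i\<in>{1..s}. x i \<in> torsion h K \<rho> m \<and> lin_indep_mod h \<rho> m {1..i} x \<and>
        (\<forall>y\<in>torsion h K \<rho> m. lin_indep_mod h \<rho> m {1..i} (x(i := y)) \<longrightarrow> w y \<le> w (x i)))"

section \<open>Lattices and Tate uniformization\<close>

text \<open>Since \<open>A\<close> is a principal ideal domain, lattices are free; the rank is the size of a basis.
  Discreteness means that every ball contains only finitely many elements.\<close>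

definition A_lattice ::
    "('k::field poly fract \<Rightarrow> 'c::field) \<Rightarrow> ('c \<Rightarrow> ereal) \<Rightarrow> 'c poly \<Rightarrow> nat \<Rightarrow> 'c set \<Rightarrow> bool" where
  "A_lattice h w \<psi> s \<Lambda> \<longleftrightarrow>
     (\<exists>b. lin_indep h \<psi> {1..s} b \<and>
        \<Lambda> = {x. \<exists>a. x = (\<Sum>i=1..s. drinfeld_act h \<psi> (a i) (b i))}) \<and>
     (\<forall>R::real. finite {x \<in> \<Lambda>. ereal R \<le> w x})"

definition lattice_abs :: "('c::field \<Rightarrow> ereal) \<Rightarrow> nat \<Rightarrow> 'c \<Rightarrow> ereal" where
  "lattice_abs w r' x =
     (if x = 0 then - \<infinity>
      else if w x < 0 then ereal ((- real_of_ereal (w x)) powr (1 / real r'))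
      else ereal (- (real_of_ereal (w x) powr (1 / real r'))))"

definition lattice_SMB ::
    "('k::field poly fract \<Rightarrow> 'c::field) \<Rightarrow> ('c \<Rightarrow> ereal) \<Rightarrow> nat \<Rightarrow> nat \<Rightarrow> 'c poly \<Rightarrow> 'c set
     \<Rightarrow> (nat \<Rightarrow> 'c) \<Rightarrow> bool" where
  "lattice_SMB h w r' r \<psi> \<Lambda> x \<longleftrightarrow>
     (\<forall>i\<in>{r'+1..r}. x i \<in> \<Lambda> \<and> lin_indep h \<psi> {r'+1..i} x \<and>
        (\<forall>y\<in>\<Lambda>. lin_indep h \<psi> {r'+1..i} (x(i := y)) \<longrightarrow>
           lattice_abs w r' (x i) \<le> lattice_abs w r' y))"

definition tate_uniformization ::
    "('k::{field,finite} poly fract \<Rightarrow> 'c::alg_closed_field) \<Rightarrow> ('c \<Rightarrow> ereal) \<Rightarrow> 'c set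
     \<Rightarrow> nat \<Rightarrow> nat \<Rightarrow> 'c poly \<Rightarrow> 'c poly \<Rightarrow> 'c set \<Rightarrow> ('c \<Rightarrow> 'c) \<Rightarrow> bool" where
  "tate_uniformization h w K r r' \<phi> \<psi> \<Lambda> e \<longleftrightarrow>
     drinfeld_module h K r' \<psi> \<and> good_reduction CARD('k) w r' \<psi> \<and>
     A_lattice h w \<psi> (r - r') \<Lambda> \<and> galois_stable w K \<Lambda> \<and> (\<forall>\<mu>\<in>\<Lambda> - {0}. w \<mu> < 0) \<and>
     (\<forall>z. limitin (val_top w) (\<lambda>S. z * (\<Prod>\<mu>\<in>S. 1 - z / \<mu>)) (e z)
            (finite_subsets_at_top (\<Lambda> - {0}))) \<and>
     is_entire w e \<and> surj e \<and> {z. e z = 0} = \<Lambda> \<and>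
     (\<forall>a z. e (drinfeld_act h \<psi> a z) = drinfeld_act h \<phi> a (e z))"

end

theory Submission
  imports Defs
begin

text \<open>
  The map \<open>e\<close> is additive with kernel \<open>\<Lambda>\<close>, so \<open>\<phi>[m]\<close>, for \<open>m = u\<^sup>n\<close>, is the quotient by \<open>\<Lambda>\<close> of
  \<open>V = {z. \<psi>\<^sub>m(z) \<in> \<Lambda>}\<close>. Since \<open>\<psi>\<close> has good reduction, \<open>w(\<psi>\<^sub>a(z)) = q\<^bsup>r' deg a\<^esup> w(z)\<close> if \<open>w(z) < 0\<close>,
  whereas \<open>\<psi>\<^sub>a\<close> preserves \<open>w(z) \<ge> 0\<close>. Division with remainder in \<open>A\<close> then shows that successive
  minima of \<open>\<Lambda>\<close> span a saturated submodule, and together with a count of \<open>\<psi>[m]\<close> this shows that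
  the \<open>e(\<omega>\<^sub>i)\<close> are independent modulo \<open>m\<close> and that \<open>w(z) \<le> w(\<omega>\<^sub>i)\<close> for every \<open>z \<in> V\<close> such that
  \<open>e(z)\<close> is independent of \<open>e(\<omega>\<^sub>1), \<dots>, e(\<omega>\<^sub>i\<^sub>-\<^sub>1)\<close>. Choosing \<open>z\<close> of maximal valuation in its coset
  modulo \<open>\<Lambda>\<close>, the product formula for \<open>e\<close> turns this into \<open>w(e(z)) \<le> w(e(\<omega>\<^sub>i))\<close>.
\<close>

section \<open>Additive polynomials and the Frobenius\<close>

text \<open>Translation by a point of \<open>V\<close> permutes the factors. So for fixed
  \<open>y\<close> the monic polynomials \<open>P(X + y)\<close> and \<open>P(X) + P(y)\<close> of
  degree \<open>card V\<close> agree at all \<open>card V\<close> points of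
  \<open>V\<close>.\<close>

lemma finite_subgroup_prod_additive:
  fixes V :: "'c::field set"
  assumes fin: "finite V" and zero: "0 \<in> V" and diff: "\<And>a b. a \<in> V \<Longrightarrow> b \<in> V \<Longrightarrow> a - b \<in> V"
  shows "(\<Prod>v\<in>V. x + y - v) = (\<Prod>v\<in>V. x - v) + (\<Prod>v\<in>V. y - v)"
proof -
  define P where "P = (\<Prod>v\<in>V. [:- v, 1:])"
  have P: "poly P z = (\<Prod>v\<in>V. z - v)" for z
    by (simp add: P_def poly_prod)
  have deg: "degree P = card V"
    unfolding P_def by (subst degree_prod_eq_sum_degree) auto
  have lc: "lead_coeff P = 1"
    unfolding P_def by (simp add: lead_coeff_prod)
  have card: "0 < card V"
    using fin zero by (auto simp: card_gt_0_iff)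
  have degc: "degree (pcompose P [:y, 1:]) = card V"
    by (simp add: degree_pcompose deg)
  have "pcompose P [:y, 1:] = P + [:poly P y:]"
  proof (rule poly_eqI_degree_lead_coeff[where n = "card V" and A = V])
    have "coeff (pcompose P [:y, 1:]) (card V) = 1"
      using lead_coeff_comp[of "[:y, 1:]" P] lc degc by simp
    moreover have "coeff (P + [:poly P y:]) (card V) = 1"
      using lc deg card by (simp add: coeff_pCons split: nat.splits)
    ultimately show "coeff (pcompose P [:y, 1:]) (card V) = coeff (P + [:poly P y:]) (card V)"
      by simp
  next
    show "degree (P + [:poly P y:]) \<le> card V"
      by (intro degree_add_le) (auto simp: deg)
  next
    fix z assume z: "z \<in> V"
    have neg: "- a \<in> V" if "a \<in> V" for a
      using diff[OF zero that] by simp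
    have add: "a + b \<in> V" if "a \<in> V" "b \<in> V" for a b
      using diff[OF that(1) neg[OF that(2)]] by simp
    have "poly P (y + z) = (\<Prod>v\<in>V. y + z - v)"
      by (simp add: P)
    also have "\<dots> = (\<Prod>v\<in>V. y - v)"
      by (rule prod.reindex_bij_witness[of _ "\<lambda>v. v + z" "\<lambda>v. v - z"])
        (use z add diff in \<open>auto simp: algebra_simps\<close>)
    finally have "poly P (y + z) = poly P y"
      by (simp add: P)
    moreover have "poly P z = 0"
      using z fin by (simp add: P)
    ultimately show "poly (pcompose P [:y, 1:]) z = poly (P + [:poly P y:]) z"
      by (simp add: poly_pcompose)
  qed (auto simp: degc)
  from arg_cong[OF this, of "\<lambda>p. poly p x"] show ?thesis
    by (simp add: poly_pcompose P algebra_simps)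
qed

text \<open>Multiplication by a nonzero \<open>c\<close> permutes the nonzero elements; cancelling
  their product leaves \<open>c ^ (CARD('k) - 1) = 1\<close>.\<close>

lemma finite_field_power_card:
  fixes c :: "'k::{field,finite}"
  shows "c ^ CARD('k) = c"
proof (cases "c = 0")
  case False
  let ?P = "\<Prod>x\<in>UNIV - {0::'k}. x"
  have "?P = (\<Prod>x\<in>UNIV - {0}. c * x)"
    by (rule prod.reindex_bij_witness[of _ "\<lambda>x. c * x" "\<lambda>x. x / c"]) (use False in auto)
  also have "\<dots> = c ^ (CARD('k) - 1) * ?P"
    by (simp add: prod.distrib card_Diff_singleton)
  finally have "c ^ (CARD('k) - 1) = 1"
    by simp
  moreover have "CARD('k) = Suc (CARD('k) - 1)"
    by simp
  ultimately show ?thesis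
    by (metis mult.right_neutral power_Suc)
qed simp

text \<open>Translation by 1 permutes the ring, so the sum of all elements does not change although
  1 is added \<open>CARD('k)\<close> times.\<close>

lemma finite_ring_of_nat_card:
  "of_nat CARD('k) = (0::'k::{comm_ring_1,finite})"
proof -
  have "(\<Sum>x\<in>UNIV. x) = (\<Sum>x\<in>UNIV. x + (1::'k))"
    by (rule sum.reindex_bij_witness[of _ "\<lambda>x. x + 1" "\<lambda>x. x - 1"]) auto
  then show ?thesis
    by (simp add: sum.distrib)
qed

lemma two_le_card_finite_field: "2 \<le> CARD('k::{field,finite})"
proof -
  have "card {0::'k, 1} \<le> CARD('k)"
    by (rule card_mono) auto
  then show ?thesis by simp
qed

section \<open>The constants of \<open>A\<close> inside the large field\<close>

locale base_hom =
  fixes h :: "'k::{field,finite} poly fract \<Rightarrow> 'c::field"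
  assumes hom: "is_field_hom h"
begin

definition cst :: "'k \<Rightarrow> 'c" where "cst c = h (to_fract [:c:])"

lemma h_add: "h (x + y) = h x + h y" and h_mult: "h (x * y) = h x * h y" and h_1: "h 1 = 1"
  using hom by (auto simp: is_field_hom_def)

lemma h_0: "h 0 = 0"
  using h_add[of 0 0] by (metis add.right_neutral add_left_cancel)

lemma h_eq_0_iff: "h x = 0 \<longleftrightarrow> x = 0"
  using h_mult[of x "inverse x"] h_0 h_1 by (cases "x = 0") auto

lemma cst_add: "cst (a + b) = cst a + cst b" and cst_mult: "cst (a * b) = cst a * cst b"
  and cst_0 [simp]: "cst 0 = 0" and cst_1 [simp]: "cst 1 = 1"
  by (simp_all add: cst_def h_0 h_1 mult.commute flip: h_add h_mult to_fract_add to_fract_mult one_pCons)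

lemma cst_eq_0_iff [simp]: "cst c = 0 \<longleftrightarrow> c = 0"
  by (simp add: cst_def h_eq_0_iff)

lemma cst_minus: "cst (- a) = - cst a"
  using cst_add[of "- a" a] by (simp add: eq_neg_iff_add_eq_0)

lemma cst_diff: "cst (a - b) = cst a - cst b"
  using cst_add[of a "- b"] by (simp add: cst_minus)

lemma cst_power: "cst (a ^ m) = cst a ^ m"
  by (induction m) (auto simp: cst_mult)

lemma inj_cst: "inj cst"
  by (rule injI) (use cst_diff in \<open>metis cst_eq_0_iff right_minus_eq\<close>)

lemma cst_power_card: "cst c ^ CARD('k) = cst c"
  by (simp add: finite_field_power_card flip: cst_power)

lemma of_nat_card_eq_0: "of_nat CARD('k) = (0::'c)"
proof -
  have "cst (of_nat m) = of_nat m" for m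
    by (induction m) (auto simp: cst_add)
  then show ?thesis
    by (metis cst_0 finite_ring_of_nat_card)
qed

text \<open>The polynomial \<open>X\<^sup>q - X\<close> is the product of \<open>X - v\<close> over the constants, which form a finite
  additive group; hence it is additive, and so is the Frobenius.\<close>

lemma frobenius_add: "(x + y :: 'c) ^ CARD('k) = x ^ CARD('k) + y ^ CARD('k)"
proof -
  let ?q = "CARD('k)"
  have fr: "(\<Prod>v\<in>range cst. z - v) = z ^ ?q - z" for z
  proof -
    have cardr: "card (range cst) = ?q"
      by (simp add: card_image inj_cst)
    have lc: "lead_coeff (\<Prod>v\<in>range cst. [:- v, 1:]) = 1"
      by (simp add: lead_coeff_prod)
    have deg: "degree (\<Prod>v\<in>range cst. [:- v, 1:]) = ?q"
      by (subst degree_prod_eq_sum_degree) (auto simp: cardr)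
    have "(\<Prod>v\<in>range cst. [:- v, 1:]) = monom 1 ?q - [:0, 1:]"
    proof (rule poly_eqI_degree_lead_coeff[where n = ?q and A = "range cst"])
      have "coeff [:0, 1::'c:] ?q = 0"
        using two_le_card_finite_field[where 'k='k] by (intro coeff_eq_0) auto
      then show "coeff (\<Prod>v\<in>range cst. [:- v, 1:]) ?q = coeff (monom 1 ?q - [:0, 1:]) ?q"
        using lc deg by simp
      show "degree (monom 1 ?q - [:0, 1::'c:]) \<le> ?q"
        using two_le_card_finite_field[where 'k='k]
        by (intro degree_diff_le) (auto simp: degree_monom_eq)
    next
      fix z assume z: "z \<in> range cst"
      then have "(\<Prod>v\<in>range cst. z - v) = 0"
        by (intro prod_zero) auto
      then show "poly (\<Prod>v\<in>range cst. [:- v, 1:]) z = poly (monom 1 ?q - [:0, 1:]) z"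
        using z by (auto simp: poly_prod poly_monom cst_power_card)
    qed (auto simp: deg cardr)
    from arg_cong[OF this, of "\<lambda>p. poly p z"] show ?thesis
      by (simp add: poly_prod poly_monom)
  qed
  have "(\<Prod>v\<in>range cst. x + y - v) = (\<Prod>v\<in>range cst. x - v) + (\<Prod>v\<in>range cst. y - v)"
  proof (rule finite_subgroup_prod_additive)
    show "0 \<in> range cst" by (metis cst_0 rangeI)
    show "a - b \<in> range cst" if "a \<in> range cst" "b \<in> range cst" for a b
      using that by (auto simp flip: cst_diff)
  qed auto
  then show ?thesis by (simp add: fr)
qed

lemma frobenius_pow_add: "(x + y :: 'c) ^ (CARD('k) ^ i) = x ^ (CARD('k) ^ i) + y ^ (CARD('k) ^ i)"
  by (induction i arbitrary: x y) (simp_all add: power_mult frobenius_add)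

lemma cst_power_card_pow: "cst c ^ (CARD('k) ^ i) = cst c"
  by (induction i) (simp_all add: power_mult cst_power_card mult.commute)

end

section \<open>The action of a Drinfeld module\<close>

text \<open>The derivative would vanish at a multiple root.\<close>

lemma rsquarefree_of_pderiv_const:
  fixes p :: "'c::field poly"
  assumes "pderiv p = [:c:]" "c \<noteq> 0"
  shows "rsquarefree p"
  unfolding rsquarefree_def
proof (intro conjI allI)
  show nz: "p \<noteq> 0" using assms by auto
  fix a
  have "\<not> 2 \<le> order a p"
  proof
    assume "2 \<le> order a p"
    then have "[:- a, 1:] ^ 2 dvd p"
      by (meson order_1 power_le_dvd)
    then obtain s where "p = [:- a, 1:] * ([:- a, 1:] * s)"
      by (metis dvdE mult.assoc power2_eq_square)
    then have "poly (pderiv p) a = 0"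
      by (simp only: pderiv_mult poly_add poly_mult) simp
    then show False using assms by simp
  qed
  then show "order a p = 0 \<or> order a p = 1" by linarith
qed

locale drinfeld = base_hom h
  for h :: "'k::{field,finite} poly fract \<Rightarrow> 'c::field" +
  fixes K :: "'c set" and s :: nat and \<rho> :: "'c poly"
  assumes drinfeld: "drinfeld_module h K s \<rho>"
begin

abbreviation act :: "'k poly \<Rightarrow> 'c \<Rightarrow> 'c" where
  "act a x \<equiv> drinfeld_act h \<rho> a x"

lemma rank_pos: "1 \<le> s"
  using drinfeld by (simp add: drinfeld_module_def)

text \<open>The exponents \<open>CARD('k) ^ i\<close> with \<open>i \<ge> 1\<close> differ from each
  other and from 1, so the existentially hidden coefficients in \<open>drinfeld_module\<close> can
  be read off from \<open>\<rho>\<close>.\<close>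

lemma coeffs:
  shows rho_eq: "\<rho> = monom (t_elem h) 1 + (\<Sum>i=1..s. monom (coeff \<rho> (CARD('k) ^ i)) (CARD('k) ^ i))"
    and coeff_in: "i \<in> {1..s} \<Longrightarrow> coeff \<rho> (CARD('k) ^ i) \<in> K"
proof -
  let ?q = "CARD('k)"
  have q: "2 \<le> ?q" by (rule two_le_card_finite_field)
  obtain a where a: "\<forall>i\<in>{1..s}. a i \<in> K"
    and rho: "\<rho> = monom (t_elem h) 1 + (\<Sum>i=1..s. monom (a i) (?q ^ i))"
    using drinfeld by (auto simp: drinfeld_module_def)
  have co: "coeff \<rho> (?q ^ i) = a i" if "i \<in> {1..s}" for i
  proof -
    have inj: "?q ^ j = ?q ^ i \<longleftrightarrow> j = i" for j
      using q by (simp add: power_inject_exp)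
    have "1 < ?q ^ i"
      using q that by (intro one_less_power) auto
    moreover have "(\<Sum>j=1..s. if ?q ^ j = ?q ^ i then a j else 0) = (\<Sum>j=1..s. if j = i then a j else 0)"
      by (simp only: inj)
    ultimately show ?thesis
      using that by (simp add: rho coeff_sum)
  qed
  have "(\<Sum>i=1..s. monom (coeff \<rho> (?q ^ i)) (?q ^ i)) = (\<Sum>i=1..s. monom (a i) (?q ^ i))"
    by (intro sum.cong) (auto simp: co)
  then show "\<rho> = monom (t_elem h) 1 + (\<Sum>i=1..s. monom (coeff \<rho> (?q ^ i)) (?q ^ i))"
    using rho by simp
  show "i \<in> {1..s} \<Longrightarrow> coeff \<rho> (?q ^ i) \<in> K"
    using a by (simp add: co)
qed

lemma poly_rho:
  "poly \<rho> x = t_elem h * x + (\<Sum>i=1..s. coeff \<rho> (CARD('k) ^ i) * x ^ (CARD('k) ^ i))"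
  by (subst rho_eq) (simp add: poly_sum poly_monom)

lemma poly_rho_add: "poly \<rho> (x + y) = poly \<rho> x + poly \<rho> y"
  by (simp add: poly_rho frobenius_pow_add algebra_simps sum.distrib)

lemma poly_rho_cst: "poly \<rho> (cst c * x) = cst c * poly \<rho> x"
  by (simp add: poly_rho power_mult_distrib cst_power_card_pow algebra_simps sum_distrib_left)

lemma degree_rho: "degree \<rho> \<le> CARD('k) ^ s"
proof (subst rho_eq, intro degree_add_le degree_sum_le)
  show "degree (monom (t_elem h) 1) \<le> CARD('k) ^ s"
    using degree_monom_le[of "t_elem h" 1] by (simp add: Suc_le_eq order.trans)
  show "degree (monom (coeff \<rho> (CARD('k) ^ i)) (CARD('k) ^ i)) \<le> CARD('k) ^ s"
    if "i \<in> {1..s}" for i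
    using that by (intro order.trans[OF degree_monom_le] power_increasing) (auto simp: Suc_le_eq)
qed auto

text \<open>\<open>CARD('k)\<close> is zero in the field, so only the linear term can
  contribute.\<close>

lemma pderiv_rho: "pderiv \<rho> = [:t_elem h:]"
proof (subst rho_eq)
  have "of_nat (CARD('k) ^ i) = (0::'c)" if "i \<in> {1..s}" for i
    using that of_nat_card_eq_0 by simp
  then have "(\<Sum>i=1..s. pderiv (monom (coeff \<rho> (CARD('k) ^ i)) (CARD('k) ^ i))) = 0"
    by (intro sum.neutral) (auto simp: pderiv_monom simp del: of_nat_power)
  moreover have "pderiv (monom (t_elem h) 1) = [:t_elem h:]"
    by (simp add: pderiv_monom monom_0)
  ultimately show "pderiv (monom (t_elem h) 1 +
      (\<Sum>i=1..s. monom (coeff \<rho> (CARD('k) ^ i)) (CARD('k) ^ i))) = [:t_elem h:]"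
    by (simp add: pderiv_add higher_pderiv_sum[of 1, simplified])
qed

section \<open>The \<open>A\<close>-module structure given by \<open>\<rho>\<close>\<close>

lemma poly_iterate: "poly ((pcompose \<rho> ^^ i) [:0, 1:]) x = (poly \<rho> ^^ i) x"
  by (induction i) (auto simp: poly_pcompose)

lemma act_eq: "act a x = (\<Sum>i\<le>degree a. cst (coeff a i) * (poly \<rho> ^^ i) x)"
  by (simp add: drinfeld_poly_def poly_sum poly_iterate cst_def)

lemma act_0_left [simp]: "act 0 x = 0"
  by (simp add: act_eq)

text \<open>Horner's rule, which drives the inductions behind the module laws.\<close>

lemma act_pCons: "act (pCons c p) x = cst c * x + act p (poly \<rho> x)"
proof (cases "p = 0")
  case True
  then show ?thesis by (simp add: act_eq)
next
  case False
  then have "act (pCons c p) x = (\<Sum>i\<le>Suc (degree p). cst (coeff (pCons c p) i) * (poly \<rho> ^^ i) x)"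
    by (simp add: act_eq)
  also have "\<dots> = cst c * x + (\<Sum>i\<le>degree p. cst (coeff p i) * (poly \<rho> ^^ i) (poly \<rho> x))"
    by (subst sum.atMost_Suc_shift) (simp add: funpow_swap1)
  finally show ?thesis by (simp add: act_eq)
qed

lemma act_1 [simp]: "act 1 x = x"
  by (simp add: one_pCons act_pCons)

lemma act_add_right: "act a (x + y) = act a x + act a y"
  by (induction a arbitrary: x y) (simp_all add: act_pCons poly_rho_add algebra_simps)

lemma act_0_right [simp]: "act a 0 = 0"
  using act_add_right[of a 0 0] by (metis add.right_neutral add_left_cancel)

lemma act_minus_right: "act a (- x) = - act a x"
  using act_add_right[of a "- x" x] by (simp add: eq_neg_iff_add_eq_0)

lemma act_diff_right: "act a (x - y) = act a x - act a y"
  using act_add_right[of a x "- y"] by (simp add: act_minus_right)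

lemma act_sum_right: "act a (\<Sum>i\<in>I. x i) = (\<Sum>i\<in>I. act a (x i))"
  by (induction I rule: infinite_finite_induct) (auto simp: act_add_right)

lemma act_poly_rho: "act a (poly \<rho> x) = poly \<rho> (act a x)"
proof (induction a arbitrary: x)
  case 0
  then show ?case by (simp add: poly_rho zero_power)
next
  case (pCons c p)
  then show ?case by (simp add: act_pCons poly_rho_add poly_rho_cst)
qed

lemma act_add_left: "act (a + b) x = act a x + act b x"
  by (induction a b arbitrary: x rule: poly_induct2) (simp_all add: act_pCons cst_add algebra_simps)

lemma act_minus_left: "act (- a) x = - act a x"
  using act_add_left[of "- a" a] by (simp add: eq_neg_iff_add_eq_0)

lemma act_diff_left: "act (a - b) x = act a x - act b x"
  using act_add_left[of a "- b"] by (simp add: act_minus_left)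

lemma act_smult: "act (smult c a) x = cst c * act a x"
  by (induction a arbitrary: x) (simp_all add: act_pCons cst_mult algebra_simps)

lemma act_mult: "act (a * b) x = act a (act b x)"
  by (induction a arbitrary: x) (simp_all add: act_pCons act_add_left act_smult act_poly_rho)

lemma act_commute: "act a (act b x) = act b (act a x)"
  by (metis act_mult mult.commute)

text \<open>By the chain rule the \<open>i\<close>-th iterate of \<open>\<rho>\<close> has
  derivative \<open>t_elem h ^ i\<close>. Consequently the polynomial of a nonzero \<open>a\<close>
  is nonzero and separable.\<close>

lemma pderiv_drinfeld_poly: "pderiv (drinfeld_poly h \<rho> a) = [:h (to_fract a):]"
proof -
  let ?t = "t_elem h"
  have it: "pderiv ((pcompose \<rho> ^^ i) [:0, 1:]) = [:?t ^ i:]" for i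
    by (induction i) (auto simp: pderiv_pcompose pderiv_rho pderiv_pCons)
  have "(\<Sum>i\<le>degree a. cst (coeff a i) * ?t ^ i) = h (to_fract a)"
  proof (induction a)
    case 0
    then show ?case by (simp add: h_0)
  next
    case (pCons c p)
    have "to_fract (pCons c p) = to_fract [:c:] + to_fract [:0, 1:] * to_fract p"
      by (simp flip: to_fract_add to_fract_mult)
    then have "h (to_fract (pCons c p)) = cst c + ?t * h (to_fract p)"
      by (simp add: h_add h_mult cst_def)
    moreover have "(\<Sum>i\<le>degree (pCons c p). cst (coeff (pCons c p) i) * ?t ^ i) =
        cst c + ?t * (\<Sum>i\<le>degree p. cst (coeff p i) * ?t ^ i)"
    proof (cases "p = 0")
      case False
      then show ?thesis
        by (simp add: sum.atMost_Suc_shift sum_distrib_left mult_ac del: sum.atMost_Suc)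
    qed simp
    ultimately show ?case using pCons by simp
  qed
  then have "[:\<Sum>i\<le>degree a. cst (coeff a i) * ?t ^ i:] = [:h (to_fract a):]"
    by simp
  moreover have "pderiv (drinfeld_poly h \<rho> a) = (\<Sum>i\<le>degree a. [:cst (coeff a i) * ?t ^ i:])"
    by (simp add: drinfeld_poly_def higher_pderiv_sum[of 1, simplified] pderiv_smult it cst_def)
  moreover have "(\<Sum>i\<in>I. [:f i:]) = [:\<Sum>i\<in>I. f i:]" for I :: "nat set" and f :: "nat \<Rightarrow> 'c"
    by (induction I rule: infinite_finite_induct) auto
  ultimately show ?thesis by simp
qed

text \<open>Each composition with \<open>\<rho>\<close> multiplies the degree by at most
  \<open>CARD('k) ^ s\<close>. The bound serves to count torsion points.\<close>

lemma degree_drinfeld_poly: "degree (drinfeld_poly h \<rho> a) \<le> CARD('k) ^ (s * degree a)"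
  unfolding drinfeld_poly_def
proof (intro degree_sum_le)
  fix i assume "i \<in> {..degree a}"
  then have i: "i \<le> degree a" by simp
  have "degree ((pcompose \<rho> ^^ j) [:0, 1:]) \<le> (CARD('k) ^ s) ^ j" for j
    by (induction j) (auto simp: degree_pcompose intro!: mult_mono degree_rho)
  from this[of i] have "degree ((pcompose \<rho> ^^ i) [:0, 1:]) \<le> CARD('k) ^ (s * i)"
    by (simp add: power_mult)
  also have "\<dots> \<le> CARD('k) ^ (s * degree a)"
    using i by (intro power_increasing) (auto simp: Suc_le_eq)
  finally show "degree (smult (h (to_fract [:coeff a i:])) ((pcompose \<rho> ^^ i) [:0, 1:]))
      \<le> CARD('k) ^ (s * degree a)"
    using degree_smult_le order.trans by blast
qed auto

lemma drinfeld_poly_nonzero: "a \<noteq> 0 \<Longrightarrow> drinfeld_poly h \<rho> a \<noteq> 0"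
  using pderiv_drinfeld_poly[of a] h_eq_0_iff[of "to_fract a"] by auto

lemma card_roots_drinfeld_poly:
  assumes "a \<noteq> 0"
  shows "card {x. act a x = 0} \<le> CARD('k) ^ (s * degree a)" "finite {x. act a x = 0}"
  using card_poly_roots_bound[OF drinfeld_poly_nonzero[OF assms]] degree_drinfeld_poly[of a]
    poly_roots_finite[OF drinfeld_poly_nonzero[OF assms]] by auto

text \<open>Polynomials over \<open>K\<close> are closed under sum, product and composition. This is
  one of the two conditions that put torsion points into \<open>sep_clos K\<close>; the other is
  separability.\<close>

lemma coeff_drinfeld_poly_in:
  assumes zero: "0 \<in> K" and K1: "1 \<in> K"
    and add: "\<And>x y. x \<in> K \<Longrightarrow> y \<in> K \<Longrightarrow> x + y \<in> K"
    and mult: "\<And>x y. x \<in> K \<Longrightarrow> y \<in> K \<Longrightarrow> x * y \<in> K"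
    and base: "range h \<subseteq> K"
  shows "coeff (drinfeld_poly h \<rho> a) i \<in> K"
proof -
  have sum: "(\<Sum>j\<in>I. f j) \<in> K" if "\<And>j. j \<in> I \<Longrightarrow> f j \<in> K" for I :: "nat set" and f
    using that by (induction I rule: infinite_finite_induct) (auto simp: zero add)
  define P where "P = {p. \<forall>i. coeff p i \<in> K}"
  have P_add: "p + p' \<in> P" and P_mult: "p * p' \<in> P" if "p \<in> P" "p' \<in> P" for p p'
    using that by (auto simp: P_def coeff_mult add intro!: sum mult)
  have P_const: "[:c:] \<in> P" if "c \<in> K" for c
    using that zero by (auto simp: P_def coeff_pCons split: nat.splits)
  have P_pcompose: "pcompose p p' \<in> P" if "p \<in> P" "p' \<in> P" for p p'
    using that(1)
  proof (induction p)
    case 0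
    then show ?case using P_const[OF zero] by simp
  next
    case (pCons c p)
    have "coeff (pCons c p) 0 \<in> K" "\<And>i. coeff (pCons c p) (Suc i) \<in> K"
      using pCons.prems unfolding P_def by blast+
    then have "c \<in> K" "p \<in> P" by (auto simp: P_def)
    then show ?case
      using pCons.IH that(2) by (simp add: pcompose_pCons P_add P_mult P_const)
  qed
  have rho: "\<rho> \<in> P"
    unfolding P_def mem_Collect_eq
  proof (subst rho_eq, intro allI)
    fix i
    show "coeff (monom (t_elem h) 1 + (\<Sum>i=1..s. monom (coeff \<rho> (CARD('k) ^ i)) (CARD('k) ^ i))) i \<in> K"
      unfolding coeff_add coeff_sum
      by (intro add sum) (use base zero coeff_in in auto)
  qed
  have X: "[:0, 1:] \<in> P"
    using zero K1 by (auto simp: P_def coeff_pCons split: nat.splits)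
  have "(pcompose \<rho> ^^ j) [:0, 1:] \<in> P" for j
    by (induction j) (auto simp: X P_pcompose rho)
  then have "coeff ((pcompose \<rho> ^^ j) [:0, 1:]) i \<in> K" for j
    by (simp add: P_def)
  then show ?thesis
    unfolding drinfeld_poly_def coeff_sum coeff_smult by (intro sum mult) (use base in auto)
qed

end

section \<open>Valuations\<close>

locale valued =
  fixes w :: "'c::field \<Rightarrow> ereal"
  assumes valuation: "is_valuation w"
begin

lemma w_mult: "w (x * y) = w x + w y" and w_add_ge: "min (w x) (w y) \<le> w (x + y)"
  and w_eq_inf: "w x = \<infinity> \<longleftrightarrow> x = 0" and w_ninf: "w x \<noteq> - \<infinity>"
  using valuation by (auto simp: is_valuation_def)

lemma w_0 [simp]: "w 0 = \<infinity>"
  by (simp add: w_eq_inf)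

lemma w_real: "x \<noteq> 0 \<Longrightarrow> \<exists>v. w x = ereal v"
  using w_ninf[of x] w_eq_inf[of x] by (cases "w x") auto

lemma w_neg_real: "w x < 0 \<Longrightarrow> \<exists>v. w x = ereal v \<and> v < 0"
  using w_real[of x] by (cases "x = 0") auto

lemma w_1 [simp]: "w 1 = 0"
  using w_mult[of 1 1] w_real[of 1] by auto

lemma w_minus [simp]: "w (- x) = w x"
proof -
  have "w (-1) = 0"
    using w_mult[of "-1" "-1"] w_real[of "-1"] by auto
  then show ?thesis using w_mult[of "-1" x] by simp
qed

lemma w_diff_commute: "w (x - y) = w (y - x)"
  by (metis minus_diff_eq w_minus)

lemma w_diff_ge: "min (w x) (w y) \<le> w (x - y)"
  using w_add_ge[of x "- y"] by simp

lemma w_add_geI: "c \<le> w x \<Longrightarrow> c \<le> w y \<Longrightarrow> c \<le> w (x + y)"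
  by (meson min.boundedI order.trans w_add_ge)

lemma w_diff_geI: "c \<le> w x \<Longrightarrow> c \<le> w y \<Longrightarrow> c \<le> w (x - y)"
  by (meson min.boundedI order.trans w_diff_ge)

lemma w_add_gtI: "c < w x \<Longrightarrow> c < w y \<Longrightarrow> c < w (x + y)"
  by (metis less_le_trans min_less_iff_conj w_add_ge)

lemma w_diff_gtI: "c < w x \<Longrightarrow> c < w y \<Longrightarrow> c < w (x - y)"
  by (metis less_le_trans min_less_iff_conj w_diff_ge)

text \<open>Otherwise \<open>x = (x + y) - y\<close> would be a difference of two elements of
  valuation above \<open>w x\<close>.\<close>

lemma w_add_eq:
  assumes "w x < w y"
  shows "w (x + y) = w x"
proof (rule antisym)
  show "w x \<le> w (x + y)"
    using assms by (intro w_add_geI) auto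
  show "w (x + y) \<le> w x"
    by (intro leI notI) (use w_diff_gtI[of "w x" "x + y" y] assms in simp)
qed

lemma w_diff_eq: "w x < w y \<Longrightarrow> w (x - y) = w x"
  using w_add_eq[of x "- y"] by simp

lemma w_sum_ge:
  assumes "\<And>i. i \<in> I \<Longrightarrow> c \<le> w (f i)"
  shows "c \<le> w (\<Sum>i\<in>I. f i)"
  using assms by (induction I rule: infinite_finite_induct) (auto intro: w_add_geI)

lemma w_sum_gt:
  assumes "\<And>i. i \<in> I \<Longrightarrow> c < w (f i)" "c < \<infinity>"
  shows "c < w (\<Sum>i\<in>I. f i)"
  using assms by (induction I rule: infinite_finite_induct) (auto intro: w_add_gtI)

lemma w_prod: "w (\<Prod>i\<in>I. f i) = (\<Sum>i\<in>I. w (f i))"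
  by (induction I rule: infinite_finite_induct) (auto simp: w_mult)

lemma w_power_real: "w x = ereal v \<Longrightarrow> w (x ^ m) = ereal (real m * v)"
  by (induction m) (auto simp: w_mult algebra_simps zero_ereal_def)

text \<open>Meant for constants, which are fixed by the Frobenius: a real \<open>v\<close> with
  \<open>m * v = v\<close> and \<open>m \<ge> 2\<close> is zero.\<close>

lemma w_eq_0_of_power_eq:
  assumes "x ^ m = x" "2 \<le> m" "x \<noteq> 0"
  shows "w x = 0"
proof -
  obtain v where v: "w x = ereal v" using w_real assms by blast
  then have "real m * v = v"
    using w_power_real[OF v, of m] assms(1) by simp
  then show ?thesis using v assms(2) by auto
qed

lemma w_power_nonneg: "0 \<le> w x \<Longrightarrow> 0 \<le> w (x ^ m)"
  by (induction m) (auto simp: w_mult)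

lemma w_div:
  assumes "y \<noteq> 0"
  shows "w (x / y) = w x - w y"
proof -
  obtain v where v: "w y = ereal v" using w_real assms by blast
  have "w x = w (x / y) + w y"
    using assms by (simp flip: w_mult)
  then show ?thesis
    by (cases "w (x / y)") (auto simp: v)
qed

section \<open>Limits and closures expressed by lower bounds on the valuation\<close>

interpretation M: Metric_space UNIV "val_dist w"
  by (rule Metric_space_val_dist[OF valuation])

lemma val_dist_less_iff: "val_dist w x y < 2 powr (- R) \<longleftrightarrow> ereal R < w (x - y)"
proof (cases "x = y")
  case False
  then obtain v where "w (x - y) = ereal v" using w_real[of "x - y"] by auto
  then show ?thesis using False by (auto simp: val_dist_def)
qed (simp add: val_dist_def)

lemma ex_powr_less: "0 < \<epsilon> \<Longrightarrow> \<exists>R. 2 powr (- R) \<le> (\<epsilon>::real)"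
  by (rule exI[of _ "- log 2 \<epsilon>"]) simp

lemma limitin_val_iff:
  "limitin (val_top w) f l F \<longleftrightarrow> (\<forall>R::real. \<forall>\<^sub>F x in F. ereal R < w (f x - l))"
  unfolding M.limitin_metric
proof (intro iffI conjI allI impI UNIV_I; (elim conjE)?)
  fix R :: real
  assume "\<forall>\<epsilon>>0. \<forall>\<^sub>F x in F. f x \<in> UNIV \<and> val_dist w (f x) l < \<epsilon>"
  from this[rule_format, of "2 powr (- R)"] show "\<forall>\<^sub>F x in F. ereal R < w (f x - l)"
    by (simp add: val_dist_less_iff)
next
  fix \<epsilon> :: real
  assume A: "\<forall>R. \<forall>\<^sub>F x in F. ereal R < w (f x - l)" and "0 < \<epsilon>"
  then obtain R where R: "2 powr (- R) \<le> \<epsilon>" using ex_powr_less by blast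
  from A[rule_format, of R] show "\<forall>\<^sub>F x in F. f x \<in> UNIV \<and> val_dist w (f x) l < \<epsilon>"
  proof eventually_elim
    case (elim x)
    then show ?case using R val_dist_less_iff[of "f x" l R] by simp
  qed
qed

lemma closure_val_iff:
  "x \<in> val_top w closure_of S \<longleftrightarrow> (\<forall>R::real. \<exists>y\<in>S. ereal R < w (x - y))"
  unfolding M.metric_closure_of mem_Collect_eq M.in_mball
proof (intro iffI conjI allI impI UNIV_I; (elim conjE)?)
  fix R :: real
  assume "\<forall>r>0. \<exists>y\<in>S. x \<in> UNIV \<and> y \<in> UNIV \<and> val_dist w x y < r"
  from this[rule_format, of "2 powr (- R)"] show "\<exists>y\<in>S. ereal R < w (x - y)"
    by (simp add: val_dist_less_iff)
next
  fix \<epsilon> :: real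
  assume A: "\<forall>R. \<exists>y\<in>S. ereal R < w (x - y)" and "0 < \<epsilon>"
  then obtain R where R: "2 powr (- R) \<le> \<epsilon>" using ex_powr_less by blast
  from A obtain y where "y \<in> S" "ereal R < w (x - y)" by blast
  with R show "\<exists>y\<in>S. x \<in> UNIV \<and> y \<in> UNIV \<and> val_dist w x y < \<epsilon>"
    using val_dist_less_iff[of x y R] by (intro bexI[of _ y]) auto
qed

lemma subset_closure_val: "S \<subseteq> val_top w closure_of S"
proof
  fix x assume "x \<in> S"
  then show "x \<in> val_top w closure_of S"
    unfolding closure_val_iff by (intro allI bexI[of _ x]) auto
qed

lemma closure_val_add:
  assumes add: "\<And>x y. x \<in> S \<Longrightarrow> y \<in> S \<Longrightarrow> x + y \<in> S"
    and "x \<in> val_top w closure_of S" "y \<in> val_top w closure_of S"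
  shows "x + y \<in> val_top w closure_of S"
  unfolding closure_val_iff
proof
  fix R :: real
  obtain x' y' where "x' \<in> S" "ereal R < w (x - x')" "y' \<in> S" "ereal R < w (y - y')"
    using assms(2,3) unfolding closure_val_iff by metis
  moreover have "x + y - (x' + y') = (x - x') + (y - y')" by simp
  ultimately show "\<exists>z\<in>S. ereal R < w (x + y - z)"
    using add w_add_gtI by metis
qed

lemma closure_val_mult:
  assumes mult: "\<And>x y. x \<in> S \<Longrightarrow> y \<in> S \<Longrightarrow> x * y \<in> S"
    and x: "x \<in> val_top w closure_of S" and y: "y \<in> val_top w closure_of S"
  shows "x * y \<in> val_top w closure_of S"
  unfolding closure_val_iff
proof
  fix R :: real
  have low: "\<exists>b. ereal b \<le> w z" for z
    using w_real[of z] by (cases "z = 0") auto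
  \<comment> \<open>The error splits as \<open>(x - x') * y + x' * (y - y')\<close>. So
    \<open>x'\<close> is chosen first, with a precision depending on \<open>y\<close>, and then
    \<open>y'\<close>, with a precision depending on \<open>x'\<close>.\<close>
  obtain b where b: "ereal b \<le> w y" using low by blast
  obtain x' where x': "x' \<in> S" "ereal (R - b) < w (x - x')"
    using x unfolding closure_val_iff by metis
  obtain a where a: "ereal a \<le> w x'" using low by blast
  obtain y' where y': "y' \<in> S" "ereal (R - a) < w (y - y')"
    using y unfolding closure_val_iff by metis
  have "ereal R < w ((x - x') * y)"
    unfolding w_mult using x'(2) b by (cases "w (x - x')"; cases "w y") auto
  moreover have "ereal R < w (x' * (y - y'))"
    unfolding w_mult using y'(2) a by (cases "w (y - y')"; cases "w x'") auto
  moreover have "x * y - x' * y' = (x - x') * y + x' * (y - y')"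
    by (simp add: algebra_simps)
  ultimately have "ereal R < w (x * y - x' * y')"
    using w_add_gtI by metis
  then show "\<exists>z\<in>S. ereal R < w (x * y - z)"
    using x'(1) y'(1) mult by blast
qed

end

section \<open>Torsion and good reduction\<close>

context drinfeld
begin

text \<open>By counting: independence makes the combinations with coefficients of degree below
  \<open>degree m\<close> pairwise distinct. There are \<open>CARD('k) ^ (s * degree m)\<close> of
  them, the maximal number of roots, so they exhaust the torsion.\<close>

lemma spanning_of_lin_indep_mod:
  assumes m: "m \<noteq> 0" and ind: "lin_indep_mod h \<rho> m {1..s} x"
    and tors: "\<And>i. i \<in> {1..s} \<Longrightarrow> act m (x i) = 0" and y: "act m y = 0"
  shows "\<exists>b. y = (\<Sum>i=1..s. act (b i) (x i))"
proof -
  let ?d = "degree m"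
  let ?D = "({1..s} \<times> {..<?d}) \<rightarrow>\<^sub>E (UNIV :: 'k set)"
  \<comment> \<open>An array \<open>c\<close> encodes \<open>s\<close> residues modulo
    \<open>m\<close>: \<open>c (i, k)\<close> is the coefficient of \<open>t ^ k\<close> in the
    \<open>i\<close>-th one.\<close>
  define p where "p = (\<lambda>(c :: nat \<times> nat \<Rightarrow> 'k) i. \<Sum>k<?d. monom (c (i, k)) k)"
  define f where "f = (\<lambda>c. \<Sum>i=1..s. act (p c i) (x i))"
  have cp: "coeff (p c i) k = (if k < ?d then c (i, k) else 0)" for c i k
    by (simp add: p_def coeff_sum)
  have "inj_on f ?D"
  proof (rule inj_onI)
    fix c c' assume cc: "c \<in> ?D" "c' \<in> ?D" "f c = f c'"
    then have "(\<Sum>i=1..s. act (p c i - p c' i) (x i)) = 0"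
      by (simp add: f_def act_diff_left sum_subtractf)
    then have dvd: "m dvd p c i - p c' i" if "i \<in> {1..s}" for i
      using ind[unfolded lin_indep_mod_def, THEN spec, of "\<lambda>i. p c i - p c' i"] that by blast
    have eq: "p c i = p c' i" if i: "i \<in> {1..s}" for i
    proof (rule ccontr)
      assume ne: "p c i \<noteq> p c' i"
      \<comment> \<open>A nonzero multiple of \<open>m\<close> has degree at least
        \<open>?d\<close>, yet the coefficients of this difference vanish from \<open>?d\<close>
        on.\<close>
      then have "?d \<le> degree (p c i - p c' i)"
        using dvd[OF i] by (intro dvd_imp_degree_le) auto
      then have "coeff (p c i - p c' i) (degree (p c i - p c' i)) = 0"
        by (simp add: cp)
      then show False using ne by (simp only: leading_coeff_0_iff) simp
    qed
    show "c = c'"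
    proof (rule PiE_ext[OF cc(1,2)])
      fix ik assume "ik \<in> {1..s} \<times> {..<?d}"
      then show "c ik = c' ik"
        using eq cp by (metis lessThan_iff mem_Sigma_iff prod.collapse)
    qed
  qed
  then have "card (f ` ?D) = CARD('k) ^ (s * ?d)"
    by (simp add: card_image card_funcsetE)
  moreover have sub: "f ` ?D \<subseteq> {y. act m y = 0}"
  proof safe
    fix c
    have "act m (f c) = (\<Sum>i=1..s. act (p c i) (act m (x i)))"
      by (simp add: f_def act_sum_right act_commute[of m])
    also have "\<dots> = 0"
      using tors by simp
    finally show "act m (f c) = 0" .
  qed
  ultimately have "f ` ?D = {y. act m y = 0}"
    using card_roots_drinfeld_poly[OF m] by (intro card_seteq) auto
  then obtain c where "y = f c" using y by blast
  then show ?thesis unfolding f_def by blast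
qed

end

text \<open>\<open>K\<close>, as the closure of \<open>F\<close>, is closed under the ring
  operations, so the polynomial is separable with coefficients in \<open>K\<close> and all its roots
  lie in \<open>sep_clos K\<close>.\<close>

lemma drinfeld_torsion_eq:
  fixes h :: "'k::{field,finite} poly fract \<Rightarrow> 'c::alg_closed_field"
  assumes "completion_at_finite_prime h w F K" "drinfeld_module h K s \<rho>" "m \<noteq> 0"
  shows "torsion h K \<rho> m = {x. drinfeld_act h \<rho> m x = 0}"
proof -
  interpret C: completion_at_finite_prime h w F K by fact
  interpret drinfeld h K s \<rho> by unfold_locales (use C.hom assms in auto)
  interpret valued w by unfold_locales (rule C.valuation)
  let ?p = "drinfeld_poly h \<rho> m"
  have F: "x + y \<in> F" "x * y \<in> F" if "x \<in> F" "y \<in> F" for x y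
    using C.subfield that by (auto simp: is_subfield_def)
  have F01: "0 \<in> F" "1 \<in> F"
    using C.subfield by (auto simp: is_subfield_def)
  have sub: "F \<subseteq> K"
    using subset_closure_val C.completion by simp
  have "coeff ?p i \<in> K" for i
  proof (rule coeff_drinfeld_poly_in)
    show "0 \<in> K" "1 \<in> K" "range h \<subseteq> K" using F01 sub C.base by auto
    show "x + y \<in> K" if "x \<in> K" "y \<in> K" for x y
      using closure_val_add[of F x y] F that C.completion by blast
    show "x * y \<in> K" if "x \<in> K" "y \<in> K" for x y
      using closure_val_mult[of F x y] F that C.completion by blast
  qed
  moreover have "rsquarefree ?p"
    using assms(3) by (intro rsquarefree_of_pderiv_const[OF pderiv_drinfeld_poly]) (simp add: h_eq_0_iff)
  ultimately show ?thesis
    by (auto simp: torsion_def sep_clos_def)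
qed

section \<open>Growth of the valuation under good reduction\<close>

locale good_drinfeld = drinfeld h K s \<rho> + valued w
  for h :: "'k::{field,finite} poly fract \<Rightarrow> 'c::field" and w K s \<rho> +
  assumes good: "good_reduction CARD('k) w s \<rho>" and finite_prime: "0 \<le> w (t_elem h)"
begin

lemma w_cst: "c \<noteq> 0 \<Longrightarrow> w (cst c) = 0"
  using w_eq_0_of_power_eq[OF cst_power_card two_le_card_finite_field] by simp

lemma w_cst_nonneg: "0 \<le> w (cst c)"
  using w_cst[of c] by (cases "c = 0") auto

lemma w_coeff_nonneg: "i \<in> {1..s} \<Longrightarrow> 0 \<le> w (coeff \<rho> (CARD('k) ^ i))"
  and w_lead_coeff: "w (coeff \<rho> (CARD('k) ^ s)) = 0"
  using good by (auto simp: good_reduction_def stable_reduction_def)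

lemma w_rho_nonneg: "0 \<le> w x \<Longrightarrow> 0 \<le> w (poly \<rho> x)"
  unfolding poly_rho
  by (intro w_add_geI w_sum_ge) (use finite_prime w_coeff_nonneg in \<open>auto simp: w_mult w_power_nonneg\<close>)

text \<open>The term of exponent \<open>CARD('k) ^ s\<close> dominates: its coefficient is a unit,
  the others are integral, and \<open>w x\<close> is negative.\<close>

lemma w_rho_neg:
  assumes v: "w x = ereal v" "v < 0"
  shows "w (poly \<rho> x) = ereal (real CARD('k) ^ s * v)"
proof -
  let ?q = "real CARD('k)"
  let ?f = "\<lambda>i. coeff \<rho> (CARD('k) ^ i) * x ^ (CARD('k) ^ i)"
  have q: "1 < ?q" using two_le_card_finite_field[where 'k='k] by simp
  have wp: "w (x ^ (CARD('k) ^ i)) = ereal (?q ^ i * v)" for i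
    using w_power_real[OF v(1), of "CARD('k) ^ i"] by simp
  have less: "?q ^ s * v < ?q ^ i * v" if "i < s" for i
    using that q v(2) by (simp add: power_strict_increasing_iff)
  have gt: "ereal (?q ^ s * v) < w (c * x ^ (CARD('k) ^ i))" if "i < s" "0 \<le> w c" for i c
    unfolding w_mult wp using less[OF that(1)] that(2) by (cases "w c") auto
  have top: "w (?f s) = ereal (?q ^ s * v)"
    by (simp add: w_mult wp w_lead_coeff)
  have split: "{1..s} = insert s {1..<s}"
    using rank_pos by auto
  have "(\<Sum>i=1..s. ?f i) = ?f s + (\<Sum>i=1..<s. ?f i)"
    by (subst split) simp
  then have "poly \<rho> x = ?f s + (t_elem h * x + (\<Sum>i=1..<s. ?f i))"
    by (simp add: poly_rho)
  moreover have "w (?f s) < w (t_elem h * x + (\<Sum>i=1..<s. ?f i))"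
    unfolding top
  proof (intro w_add_gtI w_sum_gt)
    \<comment> \<open>The linear term is the case of exponent \<open>CARD('k) ^ 0\<close>.\<close>
    show "ereal (?q ^ s * v) < w (t_elem h * x)"
      using gt[of 0 "t_elem h"] rank_pos finite_prime by simp
    show "ereal (?q ^ s * v) < w (?f i)" if "i \<in> {1..<s}" for i
      using that by (intro gt w_coeff_nonneg) auto
  qed auto
  ultimately show ?thesis
    using w_add_eq top by metis
qed

lemma w_act_nonneg: "0 \<le> w x \<Longrightarrow> 0 \<le> w (act a x)"
  by (induction a arbitrary: x) (auto simp: act_pCons w_mult w_cst_nonneg w_rho_nonneg intro!: w_add_geI)

text \<open>In Horner's rule the part \<open>act p (poly \<rho> x)\<close>, when \<open>p\<close> is
  nonzero, has strictly smaller valuation than the constant part and so determines the sum.\<close>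

lemma w_act_neg:
  assumes "w x = ereal v" "v < 0" "a \<noteq> 0"
  shows "w (act a x) = ereal (real CARD('k) ^ (s * degree a) * v)"
  using assms
proof (induction a arbitrary: x v)
  case (pCons c p)
  let ?q = "real CARD('k)"
  have q: "1 < ?q" using two_le_card_finite_field[where 'k='k] by simp
  show ?case
  proof (cases "p = 0")
    case True
    then have "c \<noteq> 0" using pCons.prems by simp
    then show ?thesis
      using True pCons.prems by (simp add: act_pCons w_mult w_cst)
  next
    case False
    have "?q ^ s * v < 0"
      using q pCons.prems(2) by (simp add: mult_pos_neg)
    then have wp: "w (act p (poly \<rho> x)) = ereal (?q ^ (s * degree p) * (?q ^ s * v))"
      using pCons.IH[OF w_rho_neg] pCons.prems False by blast
    also have "\<dots> = ereal (?q ^ (s * degree (pCons c p)) * v)"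
      using False by (simp add: power_add mult_ac)
    finally have wp: "w (act p (poly \<rho> x)) = ereal (?q ^ (s * degree (pCons c p)) * v)" .
    have "1 < ?q ^ (s * degree (pCons c p))"
      using q False rank_pos by (intro one_less_power) auto
    then have "?q ^ (s * degree (pCons c p)) * v < v"
      using pCons.prems(2) by simp
    then have "w (act p (poly \<rho> x)) < w (cst c * x)"
      unfolding wp w_mult pCons.prems(1) using w_cst_nonneg[of c] by (cases "w (cst c)") auto
    from w_add_eq[OF this] show ?thesis
      unfolding act_pCons wp by (simp only: add.commute)
  qed
qed simp

lemma w_act_neg_iff: "a \<noteq> 0 \<Longrightarrow> w (act a x) < 0 \<longleftrightarrow> w x < 0"
proof
  assume "a \<noteq> 0" "w x < 0"
  then obtain v where v: "w x = ereal v" "v < 0" using w_neg_real by blast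
  have "0 < real CARD('k) ^ (s * degree a)" by simp
  then show "w (act a x) < 0"
    using w_act_neg[OF v \<open>a \<noteq> 0\<close>] v(2) by (simp add: mult_pos_neg)
next
  assume "w (act a x) < 0"
  then show "w x < 0" using w_act_nonneg[of x a] by force
qed

end

section \<open>The exponential map of a lattice\<close>

locale tate = good_drinfeld h w K r' \<psi>
  for h :: "'k::{field,finite} poly fract \<Rightarrow> 'c::field" and w K r' \<psi> +
  fixes d :: nat and \<Lambda> :: "'c set" and e :: "'c \<Rightarrow> 'c" and \<phi> :: "'c poly"
  assumes lattice: "A_lattice h w \<psi> d \<Lambda>"
    and lattice_neg: "\<And>\<mu>. \<mu> \<in> \<Lambda> - {0} \<Longrightarrow> w \<mu> < 0"
    and product: "\<And>z. limitin (val_top w) (\<lambda>S. z * (\<Prod>\<mu>\<in>S. 1 - z / \<mu>)) (e z)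
            (finite_subsets_at_top (\<Lambda> - {0}))"
    and kernel: "{z. e z = 0} = \<Lambda>"
    and e_act: "\<And>a z. e (act a z) = drinfeld_act h \<phi> a (e z)"
begin

lemma e_eq_0_iff: "e z = 0 \<longleftrightarrow> z \<in> \<Lambda>"
  using kernel by blast

lemma finite_lattice_ball: "finite {x \<in> \<Lambda>. ereal R \<le> w x}"
  using lattice by (simp add: A_lattice_def)

lemma lattice_act: "x \<in> \<Lambda> \<Longrightarrow> act a x \<in> \<Lambda>"
  and lattice_add: "x \<in> \<Lambda> \<Longrightarrow> y \<in> \<Lambda> \<Longrightarrow> x + y \<in> \<Lambda>"
  and lattice_0: "0 \<in> \<Lambda>"
proof -
  obtain b where L: "\<And>x. x \<in> \<Lambda> \<longleftrightarrow> (\<exists>c. x = (\<Sum>i=1..d. act (c i) (b i)))"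
    using lattice unfolding A_lattice_def by blast
  show "act a x \<in> \<Lambda>" if x: "x \<in> \<Lambda>"
  proof -
    obtain c where "x = (\<Sum>i=1..d. act (c i) (b i))" using x L by blast
    then have "act a x = (\<Sum>i=1..d. act (a * c i) (b i))"
      by (simp add: act_sum_right act_mult)
    then show ?thesis unfolding L by (intro exI[of _ "\<lambda>i. a * c i"])
  qed
  show "x + y \<in> \<Lambda>" if xy: "x \<in> \<Lambda>" "y \<in> \<Lambda>"
  proof -
    obtain c c' where "x = (\<Sum>i=1..d. act (c i) (b i))" "y = (\<Sum>i=1..d. act (c' i) (b i))"
      using xy L by metis
    then have "x + y = (\<Sum>i=1..d. act (c i + c' i) (b i))"
      by (simp add: act_add_left sum.distrib)
    then show ?thesis unfolding L by (intro exI[of _ "\<lambda>i. c i + c' i"])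
  qed
  show "0 \<in> \<Lambda>" unfolding L by (rule exI[of _ "\<lambda>_. 0"]) simp
qed

lemma lattice_minus: "x \<in> \<Lambda> \<Longrightarrow> - x \<in> \<Lambda>"
  using lattice_act[of x "- 1"] by (simp add: act_minus_left)

lemma lattice_diff: "x \<in> \<Lambda> \<Longrightarrow> y \<in> \<Lambda> \<Longrightarrow> x - y \<in> \<Lambda>"
  using lattice_add[of x "- y"] lattice_minus by simp

lemma lattice_sum: "(\<And>i. i \<in> I \<Longrightarrow> f i \<in> \<Lambda>) \<Longrightarrow> (\<Sum>i\<in>I. f i) \<in> \<Lambda>"
  by (induction I rule: infinite_finite_induct) (auto simp: lattice_0 lattice_add)

lemma lattice_nonneg_eq_0: "x \<in> \<Lambda> \<Longrightarrow> 0 \<le> w x \<Longrightarrow> x = 0"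
  using lattice_neg[of x] by force

text \<open>Torsion points of \<open>\<psi>\<close> are integral, whereas nonzero lattice points
  have negative valuation.\<close>

lemma lattice_torsion_free:
  assumes "x \<in> \<Lambda>" "act a x = 0" "a \<noteq> 0"
  shows "x = 0"
  using w_act_neg_iff[OF assms(3), of x] assms lattice_nonneg_eq_0[of x] by (simp add: not_less)

text \<open>The balls of \<open>\<Lambda>\<close> are finite subgroups, so the partial products over
  them are additive, and additivity survives the limit.\<close>

lemma e_add: "e (x + y) = e x + e y"
proof (rule ccontr)
  assume ne: "e (x + y) \<noteq> e x + e y"
  define E where "E = (\<lambda>S (z::'c). z * (\<Prod>\<mu>\<in>S. 1 - z / \<mu>))"
  \<comment> \<open>The valuation of the supposed defect sets the precision of the
    approximations.\<close>
  obtain v where v: "w (e (x + y) - e x - e y) = ereal v"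
    using w_real[of "e (x + y) - e x - e y"] ne by (auto simp: algebra_simps)
  have ev: "\<forall>\<^sub>F S in finite_subsets_at_top (\<Lambda> - {0}). ereal v < w (E S z - e z)" for z
    using product[of z] unfolding limitin_val_iff E_def by blast
  have "\<forall>\<^sub>F S in finite_subsets_at_top (\<Lambda> - {0}). ereal v < w (E S x - e x) \<and>
     ereal v < w (E S y - e y) \<and> ereal v < w (E S (x + y) - e (x + y))"
    by (intro eventually_conj ev)
  then obtain X where X: "finite X" "X \<subseteq> \<Lambda> - {0}"
    and close: "\<forall>S. finite S \<and> X \<subseteq> S \<and> S \<subseteq> \<Lambda> - {0} \<longrightarrow> ereal v < w (E S x - e x) \<and>
     ereal v < w (E S y - e y) \<and> ereal v < w (E S (x + y) - e (x + y))"
    unfolding eventually_finite_subsets_at_top by (elim exE conjE)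
  \<comment> \<open>The set \<open>X\<close> need not come from a subgroup; a bound \<open>R\<close>
    on its valuations enlarges it to a ball, which is one once 0 is included.\<close>
  have "\<exists>R. \<forall>\<mu>\<in>X. ereal R \<le> w \<mu>"
    using X
  proof (induction rule: finite_induct)
    case (insert \<mu> X)
    then obtain R where R: "\<forall>\<mu>\<in>X. ereal R \<le> w \<mu>" by auto
    obtain v where "w \<mu> = ereal v" using w_real[of \<mu>] insert.prems by auto
    then have "ereal (min R v) \<le> w \<mu>" by simp
    moreover have "ereal (min R v) \<le> w \<mu>'" if "\<mu>' \<in> X" for \<mu>'
      using R that by (meson ereal_less_eq(3) min.cobounded1 order.trans)
    ultimately show ?case by blast
  qed simp
  then obtain R where R: "\<And>\<mu>. \<mu> \<in> X \<Longrightarrow> ereal R \<le> w \<mu>" by blast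
  define V where "V = {x \<in> \<Lambda>. ereal R \<le> w x}"
  have finV: "finite V" unfolding V_def by (rule finite_lattice_ball)
  have V0: "0 \<in> V" by (simp add: V_def lattice_0)
  have XV: "X \<subseteq> V - {0}" and VL: "V - {0} \<subseteq> \<Lambda> - {0}" using X R by (auto simp: V_def)
  let ?S = "V - {0}" and ?C = "\<Prod>\<mu>\<in>V - {0}. - \<mu>"
  have C: "?C \<noteq> 0" using finV by simp
  \<comment> \<open>The monic and the normalized product differ by a nonzero factor independent of
    \<open>z\<close>, so additivity carries over.\<close>
  have PE: "(\<Prod>\<mu>\<in>V. z - \<mu>) = ?C * E ?S z" for z
  proof -
    have "(\<Prod>\<mu>\<in>V. z - \<mu>) = z * (\<Prod>\<mu>\<in>?S. z - \<mu>)"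
      using prod.remove[OF finV V0, of "\<lambda>\<mu>. z - \<mu>"] by simp
    also have "(\<Prod>\<mu>\<in>?S. z - \<mu>) = (\<Prod>\<mu>\<in>?S. - \<mu> * (1 - z / \<mu>))"
      by (intro prod.cong) (auto simp: field_simps)
    also have "\<dots> = ?C * (\<Prod>\<mu>\<in>?S. 1 - z / \<mu>)"
      by (rule prod.distrib)
    finally show ?thesis by (simp only: E_def mult_ac)
  qed
  have "(\<Prod>\<mu>\<in>V. x + y - \<mu>) = (\<Prod>\<mu>\<in>V. x - \<mu>) + (\<Prod>\<mu>\<in>V. y - \<mu>)"
    by (rule finite_subgroup_prod_additive[OF finV V0]) (auto simp: V_def lattice_diff w_diff_geI)
  then have "E ?S (x + y) = E ?S x + E ?S y"
    unfolding PE using C by (metis distrib_left mult_left_cancel)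
  then have eq: "e (x + y) - e x - e y =
      ((E ?S x - e x) + (E ?S y - e y)) - (E ?S (x + y) - e (x + y))"
    by simp
  have "ereal v < w (E ?S x - e x) \<and> ereal v < w (E ?S y - e y) \<and>
      ereal v < w (E ?S (x + y) - e (x + y))"
    using close[THEN spec, THEN mp, of ?S] finV XV VL by simp
  then have "ereal v < w (e (x + y) - e x - e y)"
    unfolding eq by (intro w_diff_gtI[OF w_add_gtI]) auto
  then show False using v by simp
qed

lemma e_minus_lattice: "l \<in> \<Lambda> \<Longrightarrow> e (z - l) = e z"
  using e_add[of "z - l" l] by (simp add: e_eq_0_iff[THEN iffD2])

lemma e_sum: "e (\<Sum>i\<in>I. f i) = (\<Sum>i\<in>I. e (f i))"
  by (induction I rule: infinite_finite_induct) (auto simp: e_add e_eq_0_iff lattice_0)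

text \<open>As \<open>e\<close> is \<open>A\<close>-linear with kernel \<open>\<Lambda>\<close>, a
  relation between images is a combination of preimages that lies in
  \<open>\<Lambda>\<close>.\<close>

lemma lin_indep_mod_e_iff:
  "lin_indep_mod h \<phi> m I (\<lambda>i. e (x i)) \<longleftrightarrow>
     (\<forall>a. (\<Sum>i\<in>I. act (a i) (x i)) \<in> \<Lambda> \<longrightarrow> (\<forall>i\<in>I. m dvd a i))"
  unfolding lin_indep_mod_def by (simp flip: e_act e_sum add: e_eq_0_iff)

text \<open>Subtracting a lattice point of valuation below \<open>w z\<close> only lowers the
  valuation, so the maximum is sought among the finitely many others.\<close>

lemma ex_coset_max:
  "\<exists>l\<in>\<Lambda>. \<forall>\<mu>\<in>\<Lambda>. w (z - l - \<mu>) \<le> w (z - l)"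
proof (cases "z = 0")
  case True
  then show ?thesis using lattice_0 by (intro bexI[of _ 0]) auto
next
  case False
  then obtain v where v: "w z = ereal v" using w_real by blast
  let ?S = "{x \<in> \<Lambda>. ereal v \<le> w x}"
  have fin: "finite ?S" by (rule finite_lattice_ball)
  have S0: "0 \<in> ?S" using lattice_0 by simp
  let ?W = "(\<lambda>x. w (z - x)) ` ?S"
  have "Max ?W \<in> ?W" using fin S0 by (intro Max_in) auto
  then obtain l where l: "l \<in> ?S" "w (z - l) = Max ?W" by auto
  have max: "w (z - x) \<le> w (z - l)" if "x \<in> ?S" for x
    using that fin l(2) by (auto intro!: Max_ge)
  have "w (z - l - \<mu>) \<le> w (z - l)" if \<mu>: "\<mu> \<in> \<Lambda>" for \<mu>
  proof (cases "l + \<mu> \<in> ?S")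
    case True
    from max[OF this] show ?thesis by (simp add: algebra_simps)
  next
    case False
    then have lt: "w (l + \<mu>) < w z"
      using lattice_add[of l \<mu>] l(1) \<mu> v by auto
    have "w (z - l - \<mu>) = w ((l + \<mu>) - z)"
      by (subst w_diff_commute) (simp add: algebra_simps)
    also have "\<dots> = w (l + \<mu>)" by (rule w_diff_eq[OF lt])
    also have "\<dots> \<le> w (z - 0)" using lt by simp
    also have "\<dots> \<le> w (z - l)" by (rule max[OF S0])
    finally show ?thesis .
  qed
  then show ?thesis using l(1) by blast
qed

text \<open>If \<open>x\<close> has maximal valuation in its coset, then \<open>w (x - \<mu>) = min (w x) (w \<mu>)\<close> for all
  \<open>\<mu>\<close>, so the comparison holds for each factor of the product defining \<open>e\<close>.\<close>

lemma w_e_mono: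
  assumes max: "\<And>\<mu>. \<mu> \<in> \<Lambda> \<Longrightarrow> w (x - \<mu>) \<le> w x" and le: "w x \<le> w y"
  shows "w (e x) \<le> w (e y)"
proof (rule ccontr)
  assume "\<not> ?thesis"
  then have lt: "w (e y) < w (e x)" by simp
  define E where "E = (\<lambda>S (z::'c). z * (\<Prod>\<mu>\<in>S. 1 - z / \<mu>))"
  \<comment> \<open>One finite product close to both values up to \<open>v\<close> suffices: it has
    valuation exactly \<open>v\<close> at \<open>y\<close> and above \<open>v\<close> at
    \<open>x\<close>.\<close>
  obtain v where v: "w (e y) = ereal v"
    using w_real[of "e y"] lt by (cases "e y = 0") auto
  have ev: "\<forall>\<^sub>F S in finite_subsets_at_top (\<Lambda> - {0}). ereal v < w (E S z - e z)" for z
    using product[of z] unfolding limitin_val_iff E_def by blast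
  have "\<forall>\<^sub>F S in finite_subsets_at_top (\<Lambda> - {0}). ereal v < w (E S x - e x) \<and>
     ereal v < w (E S y - e y)"
    by (intro eventually_conj ev)
  then obtain S where S: "S \<subseteq> \<Lambda> - {0}"
    and Sx: "ereal v < w (E S x - e x)" and Sy: "ereal v < w (E S y - e y)"
    unfolding eventually_finite_subsets_at_top by blast
  have "ereal v < w (E S x)"
    using w_add_gtI[OF Sx, of "e x"] lt v by simp
  moreover have "w (E S y) = ereal v"
    using w_add_eq[of "e y" "E S y - e y"] Sy v by simp
  moreover have "w (E S x) \<le> w (E S y)"
  proof -
    have "w (1 - x / \<mu>) \<le> w (1 - y / \<mu>)" if \<mu>: "\<mu> \<in> S" for \<mu>
    proof -
      have \<mu>': "\<mu> \<in> \<Lambda>" "\<mu> \<noteq> 0" using S \<mu> by auto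
      have eq: "w (1 - z / \<mu>) = w (z - \<mu>) - w \<mu>" for z
      proof -
        have "1 - z / \<mu> = (\<mu> - z) / \<mu>" using \<mu>' by (simp add: field_simps)
        then show ?thesis using w_div[OF \<mu>'(2)] w_diff_commute by simp
      qed
      have "w (x - \<mu>) \<le> w \<mu>"
      proof (rule ccontr)
        assume "\<not> ?thesis"
        then have "w \<mu> < w (x - \<mu>)" by simp
        moreover from this have "w \<mu> < w x" using max[OF \<mu>'(1)] by simp
        ultimately show False using w_diff_eq[of \<mu> x] w_diff_commute[of \<mu> x] by simp
      qed
      then have "w (x - \<mu>) \<le> w (y - \<mu>)"
        using max[OF \<mu>'(1)] le by (intro w_diff_geI) auto
      then show ?thesis unfolding eq by (intro ereal_minus_mono) auto
    qed
    then show ?thesis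
      unfolding E_def w_mult w_prod using le by (intro add_mono sum_mono) auto
  qed
  ultimately show False by simp
qed

text \<open>Nonzero lattice points have negative valuation, where \<open>lattice_abs\<close> is a
  strictly increasing function of \<open>- w x\<close>.\<close>

lemma w_le_of_lattice_abs_le:
  assumes "x \<in> \<Lambda>" "y \<in> \<Lambda>" "lattice_abs w r' x \<le> lattice_abs w r' y"
  shows "w y \<le> w x"
proof (cases "x = 0")
  case False
  then have "y \<noteq> 0" using assms(3) by (auto simp: lattice_abs_def split: if_splits)
  then obtain a b where ab: "w x = ereal a" "a < 0" "w y = ereal b" "b < 0"
    using False lattice_neg[of x] lattice_neg[of y] w_neg_real[of x] w_neg_real[of y] assms by auto
  have "(- a) powr (1 / real r') \<le> (- b) powr (1 / real r')"
    using assms(3) False \<open>y \<noteq> 0\<close> ab by (simp add: lattice_abs_def)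
  then have "- a \<le> - b"
    using powr_less_mono2[of "1 / real r'" "- b" "- a"] ab rank_pos by force
  then show ?thesis using ab by simp
qed simp

end

section \<open>Successive minima\<close>

locale tate_SMB = tate h w K r' \<psi> d \<Lambda> e \<phi>
  for h :: "'k::{field,finite} poly fract \<Rightarrow> 'c::field" and w K r' \<psi> d \<Lambda> e \<phi> +
  fixes r :: nat and \<omega>0 :: "nat \<Rightarrow> 'c"
  assumes SMB: "lattice_SMB h w r' r \<psi> \<Lambda> \<omega>0"
begin

lemma SMB_in: "i \<in> {r'+1..r} \<Longrightarrow> \<omega>0 i \<in> \<Lambda>"
  using SMB by (auto simp: lattice_SMB_def)

lemma SMB_indep:
  assumes "i \<le> r" "(\<Sum>j=r'+1..i. act (a j) (\<omega>0 j)) = 0" "j \<in> {r'+1..i}"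
  shows "a j = 0"
proof -
  have "i \<in> {r'+1..r}" using assms by auto
  then have "lin_indep h \<psi> {r'+1..i} \<omega>0"
    using SMB unfolding lattice_SMB_def by blast
  then show ?thesis using assms(2,3) unfolding lin_indep_mod_def by auto
qed

text \<open>Minimality in terms of \<open>w\<close>, which reverses the order, with the term of the
  competitor \<open>y\<close> split off from the sum.\<close>

lemma SMB_max:
  assumes "i \<in> {r'+1..r}" "y \<in> \<Lambda>"
    and ind: "\<And>a. (\<Sum>j=r'+1..i-1. act (a j) (\<omega>0 j)) + act (a i) y = 0 \<Longrightarrow> \<forall>j\<in>{r'+1..i}. a j = 0"
  shows "w y \<le> w (\<omega>0 i)"
proof -
  have split: "{r'+1..i} = insert i {r'+1..i-1}" using assms(1) by auto
  have "lin_indep h \<psi> {r'+1..i} (\<omega>0(i := y))"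
    unfolding lin_indep_mod_def
  proof (intro allI impI)
    fix a assume "(\<Sum>j=r'+1..i. act (a j) ((\<omega>0(i := y)) j)) = 0"
    moreover have "(\<Sum>j=r'+1..i. act (a j) ((\<omega>0(i := y)) j)) =
        act (a i) y + (\<Sum>j=r'+1..i-1. act (a j) ((\<omega>0(i := y)) j))"
      unfolding split using assms(1) by (subst sum.insert) auto
    moreover have "(\<Sum>j=r'+1..i-1. act (a j) ((\<omega>0(i := y)) j)) = (\<Sum>j=r'+1..i-1. act (a j) (\<omega>0 j))"
      using assms(1) by (intro sum.cong) auto
    ultimately have "\<forall>j\<in>{r'+1..i}. a j = 0"
      by (intro ind) (simp add: add.commute)
    then show "\<forall>j\<in>{r'+1..i}. 0 dvd a j" by simp
  qed
  then have "lattice_abs w r' (\<omega>0 i) \<le> lattice_abs w r' y"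
    using SMB assms(1,2) unfolding lattice_SMB_def by blast
  then show ?thesis
    using w_le_of_lattice_abs_le SMB_in assms(1,2) by blast
qed

lemma SMB_nonzero:
  assumes "i \<in> {r'+1..r}"
  shows "\<omega>0 i \<noteq> 0"
proof
  assume z: "\<omega>0 i = 0"
  have "(\<Sum>j=r'+1..i. act (if j = i then 1 else 0) (\<omega>0 j)) = 0"
    using z by (intro sum.neutral) auto
  from SMB_indep[OF _ this, of i] show False using assms by simp
qed

lemma SMB_neg: "i \<in> {r'+1..r} \<Longrightarrow> w (\<omega>0 i) < 0"
  using SMB_nonzero SMB_in lattice_neg by blast

text \<open>The later minimum \<open>\<omega>0 i\<close> is an admissible competitor at the earlier
  place \<open>j\<close>.\<close>

lemma SMB_antimono:
  assumes "j \<in> {r'+1..r}" "i \<in> {r'+1..r}" "j \<le> i"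
  shows "w (\<omega>0 i) \<le> w (\<omega>0 j)"
proof (cases "j = i")
  case False
  then have ji: "j < i" using assms by simp
  show ?thesis
  proof (rule SMB_max[OF assms(1) SMB_in[OF assms(2)]])
    fix a assume z: "(\<Sum>l=r'+1..j-1. act (a l) (\<omega>0 l)) + act (a j) (\<omega>0 i) = 0"
    \<comment> \<open>The coefficient \<open>a j\<close> moves to place \<open>i\<close> and the gap
      is filled with zeros, so independence up to \<open>i\<close> applies.\<close>
    define b where "b = (\<lambda>l. if l = i then a j else if l < j then a l else 0)"
    have "(\<Sum>l=r'+1..i. act (b l) (\<omega>0 l)) = (\<Sum>l\<in>insert i {r'+1..j-1}. act (b l) (\<omega>0 l))"
      using ji assms(1) by (intro sum.mono_neutral_right) (auto simp: b_def)
    also have "\<dots> = act (b i) (\<omega>0 i) + (\<Sum>l=r'+1..j-1. act (b l) (\<omega>0 l))"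
      using ji by (subst sum.insert) auto
    also have "(\<Sum>l=r'+1..j-1. act (b l) (\<omega>0 l)) = (\<Sum>l=r'+1..j-1. act (a l) (\<omega>0 l))"
      using ji assms(1) by (intro sum.cong) (auto simp: b_def)
    finally have "(\<Sum>l=r'+1..i. act (b l) (\<omega>0 l)) = 0"
      using z by (simp add: b_def add.commute)
    then have b: "b l = 0" if "l \<in> {r'+1..i}" for l
      using SMB_indep that assms(2) by simp
    show "\<forall>l\<in>{r'+1..j}. a l = 0"
    proof
      fix l assume l: "l \<in> {r'+1..j}"
      show "a l = 0"
        using b[of l] b[of i] l ji assms(2) by (cases "l = j") (auto simp: b_def split: if_splits)
    qed
  qed
qed simp

text \<open>Reducing the coefficients modulo \<open>a\<close>, a nonzero remainder would make \<open>y\<close> independent of the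
  earlier minima and strictly shorter than the last minimum involved.\<close>

lemma SMB_dvd:
  assumes i: "i \<le> r" and a: "a \<noteq> 0" and y: "y \<in> \<Lambda>"
    and eq: "(\<Sum>j=r'+1..i. act (c j) (\<omega>0 j)) = act a y" and j: "j \<in> {r'+1..i}"
  shows "a dvd c j"
proof (rule ccontr)
  assume ndvd: "\<not> a dvd c j"
  let ?q = "real CARD('k)"
  have q: "1 < ?q" using two_le_card_finite_field[where 'k='k] by simp
  define f where "f = (\<lambda>j. c j mod a)"
  \<comment> \<open>The quotients are absorbed into \<open>z\<close>, so that \<open>act a z\<close>
    is the combination of the minima with the remainders \<open>f\<close> as coefficients.\<close>
  define z where "z = y - (\<Sum>j=r'+1..i. act (c j div a) (\<omega>0 j))"
  define J where "J = {j \<in> {r'+1..i}. f j \<noteq> 0}"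
  define k where "k = Max J"
  have "finite J" by (simp add: J_def)
  moreover have "j \<in> J" using j ndvd by (simp add: J_def f_def mod_eq_0_iff_dvd)
  ultimately have "k \<in> J" and kmax: "\<And>l. l \<in> J \<Longrightarrow> l \<le> k"
    unfolding k_def by (auto intro: Max_in)
  then have k: "k \<in> {r'+1..i}" "f k \<noteq> 0" by (auto simp: J_def)
  then have kr: "k \<in> {r'+1..r}" using i by auto
  have zL: "z \<in> \<Lambda>"
    unfolding z_def using i by (intro lattice_diff y lattice_sum lattice_act SMB_in) auto
  have "(\<Sum>j=r'+1..i. act (f j) (\<omega>0 j)) = act a z"
  proof -
    have fj: "f j = c j - a * (c j div a)" for j
      by (simp add: f_def minus_mult_div_eq_mod)
    have "(\<Sum>j=r'+1..i. act (f j) (\<omega>0 j)) =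
        (\<Sum>j=r'+1..i. act (c j) (\<omega>0 j)) - (\<Sum>j=r'+1..i. act a (act (c j div a) (\<omega>0 j)))"
      unfolding fj act_diff_left act_mult by (rule sum_subtractf)
    then show ?thesis
      by (simp only: eq z_def act_diff_right act_sum_right)
  qed
  moreover have "(\<Sum>j=r'+1..i. act (f j) (\<omega>0 j)) = (\<Sum>j=r'+1..k. act (f j) (\<omega>0 j))"
  proof (rule sum.mono_neutral_right)
    show "\<forall>l\<in>{r'+1..i} - {r'+1..k}. act (f l) (\<omega>0 l) = 0"
    proof
      fix l assume l: "l \<in> {r'+1..i} - {r'+1..k}"
      then have "l \<notin> J" using kmax[of l] by auto
      then have "f l = 0" using l by (simp add: J_def)
      then show "act (f l) (\<omega>0 l) = 0" by simp
    qed
  qed (use k in auto)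
  ultimately have fz: "(\<Sum>j=r'+1..k. act (f j) (\<omega>0 j)) = act a z" by simp
  have split: "{r'+1..k} = insert k {r'+1..k-1}" using k by auto
  \<comment> \<open>A relation between \<open>z\<close> and the earlier minima, multiplied by
    \<open>a\<close>, becomes one between minima in which \<open>\<omega>0 k\<close> has coefficient
    \<open>b k * f k\<close>. As \<open>f k\<close> is nonzero, \<open>b k\<close> vanishes, and
    then so do the others.\<close>
  have wz: "w z \<le> w (\<omega>0 k)"
  proof (rule SMB_max[OF kr zL])
    fix b assume b: "(\<Sum>j=r'+1..k-1. act (b j) (\<omega>0 j)) + act (b k) z = 0"
    define g where "g = (\<lambda>j. if j = k then 0 else b j)"
    have "(\<Sum>j=r'+1..k. act (g j) (\<omega>0 j)) = (\<Sum>j=r'+1..k-1. act (g j) (\<omega>0 j))"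
      unfolding split using k by (subst sum.insert) (auto simp: g_def)
    also have "\<dots> = (\<Sum>j=r'+1..k-1. act (b j) (\<omega>0 j))"
      using k by (intro sum.cong) (auto simp: g_def)
    finally have g: "(\<Sum>j=r'+1..k. act (g j) (\<omega>0 j)) + act (b k) z = 0"
      using b by simp
    have "(\<Sum>j=r'+1..k. act (a * g j + b k * f j) (\<omega>0 j)) =
        act a (\<Sum>j=r'+1..k. act (g j) (\<omega>0 j)) + act (b k) (\<Sum>j=r'+1..k. act (f j) (\<omega>0 j))"
      by (simp only: act_add_left act_mult sum.distrib act_sum_right)
    also have "\<dots> = act a ((\<Sum>j=r'+1..k. act (g j) (\<omega>0 j)) + act (b k) z)"
      by (simp only: fz act_add_right act_commute[of "b k" a])
    finally have "(\<Sum>j=r'+1..k. act (a * g j + b k * f j) (\<omega>0 j)) = 0"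
      by (simp only: g act_0_right)
    then have 0: "a * g l + b k * f l = 0" if "l \<in> {r'+1..k}" for l
      using SMB_indep[of k "\<lambda>j. a * g j + b k * f j"] that kr by simp
    have "b k = 0" using 0[of k] k by (simp add: g_def)
    then have "b l = 0" if "l \<in> {r'+1..k}" for l
      using 0[OF that] a by (cases "l = k") (auto simp: g_def)
    then show "\<forall>l\<in>{r'+1..k}. b l = 0" by blast
  qed
  obtain v where v: "w (\<omega>0 k) = ereal v" "v < 0"
    using w_neg_real[OF SMB_neg[OF kr]] by blast
  obtain v' where v': "w z = ereal v'" "v' < 0"
    using w_neg_real[OF le_less_trans[OF wz SMB_neg[OF kr]]] by blast
  then have "v' \<le> v" using wz v by simp
  \<comment> \<open>Both sides of \<open>fz\<close> are compared: each remainder has degree below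
    \<open>degree a\<close> and each \<open>\<omega>0 l\<close> has valuation at least
    \<open>v\<close>, so the sum has larger valuation than \<open>act a z\<close>.\<close>
  have "w (act a z) = ereal (?q ^ (r' * degree a) * v')"
    using w_act_neg[OF v'(1,2) a] .
  also have "\<dots> \<le> ereal (?q ^ (r' * degree a) * v)"
    using \<open>v' \<le> v\<close> q by (simp add: mult_left_mono)
  also have "\<dots> < w (\<Sum>j=r'+1..k. act (f j) (\<omega>0 j))"
  proof (rule w_sum_gt)
    fix l assume l: "l \<in> {r'+1..k}"
    then have lr: "l \<in> {r'+1..r}" using kr by auto
    show "ereal (?q ^ (r' * degree a) * v) < w (act (f l) (\<omega>0 l))"
    proof (cases "f l = 0")
      case False
      obtain v'' where v'': "w (\<omega>0 l) = ereal v''" "v'' < 0"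
        using w_neg_real[OF SMB_neg[OF lr]] by blast
      have "v \<le> v''"
        using SMB_antimono[OF lr kr] l v v'' by simp
      have "degree (f l) < degree a"
        using degree_mod_less[OF a, of "c l"] False by (auto simp: f_def)
      then have "?q ^ (r' * degree (f l)) < ?q ^ (r' * degree a)"
        using q rank_pos by (intro power_strict_increasing) auto
      then have "?q ^ (r' * degree a) * v < ?q ^ (r' * degree (f l)) * v"
        using v(2) by simp
      also have "\<dots> \<le> ?q ^ (r' * degree (f l)) * v''"
        using \<open>v \<le> v''\<close> q by (intro mult_left_mono) auto
      finally show ?thesis
        using w_act_neg[OF v'' False] by simp
    qed simp
  qed simp
  finally show False using fz by simp
qed

text \<open>Such a \<open>y\<close> cannot be independent of the earlier minima, so a nonzero
  multiple of it lies in their span. By \<open>SMB_dvd\<close> the multiplier divides all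
  coefficients, and it cancels because \<open>\<Lambda>\<close> is torsion free.\<close>

lemma SMB_span:
  assumes i: "i \<in> {r'+1..r}" and y: "y \<in> \<Lambda>" and less: "w (\<omega>0 i) < w y"
  shows "\<exists>b. y = (\<Sum>j=r'+1..i-1. act (b j) (\<omega>0 j))"
proof -
  have "\<not> w y \<le> w (\<omega>0 i)" using less by simp
  then obtain a where a: "(\<Sum>j=r'+1..i-1. act (a j) (\<omega>0 j)) + act (a i) y = 0"
    and nz: "\<exists>j\<in>{r'+1..i}. a j \<noteq> 0"
    using SMB_max[OF i y] by blast
  have ir: "i - 1 \<le> r" using i by auto
  \<comment> \<open>Otherwise the relation would involve the independent earlier minima
    alone.\<close>
  have ai: "a i \<noteq> 0"
  proof
    assume z: "a i = 0"
    then have "a j = 0" if "j \<in> {r'+1..i-1}" for j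
      using SMB_indep[OF ir _ that, of a] a by simp
    moreover obtain j where "j \<in> {r'+1..i}" "a j \<noteq> 0" using nz by blast
    ultimately show False using z by (cases "j = i") auto
  qed
  have eq: "(\<Sum>j=r'+1..i-1. act (- a j) (\<omega>0 j)) = act (a i) y"
    using a by (simp add: act_minus_left sum_negf neg_eq_iff_add_eq_0)
  define b where "b = (\<lambda>j. - a j div a i)"
  have b: "a i * b j = - a j" if "j \<in> {r'+1..i-1}" for j
    using SMB_dvd[OF ir ai y eq that] unfolding b_def by (rule dvd_mult_div_cancel)
  let ?s = "\<Sum>j=r'+1..i-1. act (b j) (\<omega>0 j)"
  have "act (a i) ?s = (\<Sum>j=r'+1..i-1. act (- a j) (\<omega>0 j))"
    unfolding act_sum_right by (intro sum.cong refl) (simp only: b flip: act_mult)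
  then have "act (a i) (y - ?s) = 0"
    using eq by (simp add: act_diff_right)
  moreover have "y - ?s \<in> \<Lambda>"
    using i by (intro lattice_diff y lattice_sum lattice_act SMB_in) auto
  ultimately have "y - ?s = 0"
    using lattice_torsion_free ai by blast
  then show ?thesis by auto
qed

end

section \<open>Division points of the lattice\<close>

locale tate_torsion = tate_SMB h w K r' \<psi> d \<Lambda> e \<phi> r \<omega>0
  for h :: "'k::{field,finite} poly fract \<Rightarrow> 'c::field" and w K r' \<psi> d \<Lambda> e \<phi> r \<omega>0 +
  fixes m :: "'k poly" and \<omega> :: "nat \<Rightarrow> 'c"
  assumes m: "m \<noteq> 0" "\<not> m dvd 1"
    and tors: "\<And>i. i \<in> {1..r'} \<Longrightarrow> act m (\<omega> i) = 0"
    and tors_indep: "\<And>i. i \<in> {1..r'} \<Longrightarrow> lin_indep_mod h \<psi> m {1..i} \<omega>"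
    \<comment> \<open>Unparenthesised, \<open>\<omega>(\<dots>)\<close> would be read as a Landau symbol.\<close>
    and tors_max: "\<And>i y. i \<in> {1..r'} \<Longrightarrow> act m y = 0 \<Longrightarrow>
       lin_indep_mod h \<psi> m {1..i} ((\<omega>)(i := y)) \<Longrightarrow> w y \<le> w (\<omega> i)"
    and root: "\<And>i. i \<in> {r'+1..r} \<Longrightarrow> act m (\<omega> i) = \<omega>0 i"
begin

lemma act_omega_in: "i \<in> {1..r} \<Longrightarrow> act m (\<omega> i) \<in> \<Lambda>"
  using tors[of i] root[of i] SMB_in[of i] lattice_0 by (cases "i \<le> r'") auto

text \<open>The sum is a lattice point killed by \<open>m\<close>, hence zero.\<close>

lemma dvd_of_sum_in_lattice_le:
  assumes i: "i \<in> {1..r'}" and S: "(\<Sum>j=1..i. act (a j) (\<omega> j)) \<in> \<Lambda>" and j: "j \<in> {1..i}"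
  shows "m dvd a j"
proof -
  have "act m (\<Sum>j=1..i. act (a j) (\<omega> j)) = (\<Sum>j=1..i. act (a j) (act m (\<omega> j)))"
    unfolding act_sum_right by (simp only: act_commute[of m])
  also have "\<dots> = 0"
    using i tors by (intro sum.neutral) auto
  finally have "(\<Sum>j=1..i. act (a j) (\<omega> j)) = 0"
    using lattice_torsion_free S m by blast
  then show ?thesis
    using tors_indep[OF i] j unfolding lin_indep_mod_def by blast
qed

text \<open>Applying \<open>m\<close> kills the torsion part and leaves a combination of minima
  equal to \<open>m\<close> times a lattice point, so \<open>SMB_dvd\<close> handles the indices
  above \<open>r'\<close>. Their terms then lie in \<open>\<Lambda>\<close>, and subtracting them
  leaves the torsion case.\<close>

lemma dvd_of_sum_in_lattice:
  assumes i: "i \<in> {1..r}" and S: "(\<Sum>j=1..i. act (a j) (\<omega> j)) \<in> \<Lambda>" and j: "j \<in> {1..i}"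
  shows "m dvd a j"
proof (cases "i \<le> r'")
  case True
  then show ?thesis using dvd_of_sum_in_lattice_le[of i a j] assms by auto
next
  case False
  have split: "(\<Sum>j=1..i. f j) = (\<Sum>j=1..r'. f j) + (\<Sum>j=r'+1..i. f j)" for f :: "nat \<Rightarrow> 'c"
  proof -
    have "{1..i} = {1..r'} \<union> {r'+1..i}" using False by auto
    then show ?thesis by (simp only:) (subst sum.union_disjoint, auto)
  qed
  have "act m (\<Sum>j=1..i. act (a j) (\<omega> j)) = (\<Sum>j=1..i. act (a j) (act m (\<omega> j)))"
    unfolding act_sum_right by (simp only: act_commute[of m])
  also have "\<dots> = (\<Sum>j=1..r'. act (a j) (act m (\<omega> j))) + (\<Sum>j=r'+1..i. act (a j) (act m (\<omega> j)))"
    by (rule split)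
  also have "(\<Sum>j=1..r'. act (a j) (act m (\<omega> j))) = 0"
    using tors by (intro sum.neutral) auto
  also have "(\<Sum>j=r'+1..i. act (a j) (act m (\<omega> j))) = (\<Sum>j=r'+1..i. act (a j) (\<omega>0 j))"
    using i by (intro sum.cong) (auto simp: root)
  finally have eq: "(\<Sum>j=r'+1..i. act (a j) (\<omega>0 j)) = act m (\<Sum>j=1..i. act (a j) (\<omega> j))"
    by simp
  have hi: "m dvd a l" if "l \<in> {r'+1..i}" for l
    using SMB_dvd[OF _ m(1) S eq that] i by simp
  have "act (a l) (\<omega> l) \<in> \<Lambda>" if l: "l \<in> {r'+1..i}" for l
  proof -
    obtain b where "a l = b * m" using hi[OF l] by (metis dvdE mult.commute)
    then have "act (a l) (\<omega> l) = act b (act m (\<omega> l))" by (simp add: act_mult)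
    then show ?thesis
      using l i by (auto intro!: lattice_act act_omega_in)
  qed
  then have "(\<Sum>j=r'+1..i. act (a j) (\<omega> j)) \<in> \<Lambda>"
    by (rule lattice_sum)
  then have "(\<Sum>j=1..r'. act (a j) (\<omega> j)) \<in> \<Lambda>"
    using lattice_diff[OF S] split[of "\<lambda>j. act (a j) (\<omega> j)"] by fastforce
  then have lo: "m dvd a l" if "l \<in> {1..r'}" for l
    using dvd_of_sum_in_lattice_le[of r' a l] that rank_pos by simp
  show ?thesis using hi[of j] lo[of j] j by (cases "j \<le> r'") auto
qed

lemma lin_indep_e_omega: "i \<in> {1..r} \<Longrightarrow> lin_indep_mod h \<phi> m {1..i} (\<lambda>j. e (\<omega> j))"
  unfolding lin_indep_mod_e_iff using dvd_of_sum_in_lattice by blast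

text \<open>A larger \<open>w z\<close> contradicts the choice of \<open>\<omega> i\<close> in
  \<open>\<psi>[m]\<close> if \<open>i \<le> r'\<close>. If \<open>i > r'\<close>, it puts
  \<open>act m z\<close> into the span of the earlier minima, and \<open>z\<close> becomes a
  combination of the earlier \<open>\<omega> j\<close>.\<close>

lemma w_le_of_lin_indep_e:
  assumes i: "i \<in> {1..r}" and z: "act m z \<in> \<Lambda>"
    and ind: "lin_indep_mod h \<phi> m {1..i} ((\<lambda>j. e (\<omega> j))(i := e z))"
  shows "w z \<le> w (\<omega> i)"
proof (rule ccontr)
  assume "\<not> ?thesis"
  then have less: "w (\<omega> i) < w z" by simp
  have "(\<lambda>j. e (\<omega> j))(i := e z) = (\<lambda>j. e (((\<omega>)(i := z)) j))" by auto
  then have dvd: "m dvd a j" if "(\<Sum>j=1..i. act (a j) (((\<omega>)(i := z)) j)) \<in> \<Lambda>" "j \<in> {1..i}" for a j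
    using ind that by (simp only: lin_indep_mod_e_iff)
  show False
  proof (cases "i \<le> r'")
    case True
    then have i': "i \<in> {1..r'}" using i by simp
    \<comment> \<open>Torsion points are integral, hence so are \<open>z\<close> and the lattice
      point \<open>act m z\<close>, which must then be 0.\<close>
    have "0 \<le> w (\<omega> i)"
      using w_act_neg_iff[OF m(1), of "\<omega> i"] tors[OF i'] by (simp add: not_less)
    then have "0 \<le> w (act m z)" using less by (intro w_act_nonneg) auto
    then have "act m z = 0" using z lattice_nonneg_eq_0 by blast
    moreover have "lin_indep_mod h \<psi> m {1..i} ((\<omega>)(i := z))"
      unfolding lin_indep_mod_def using dvd lattice_0 by metis
    ultimately show False using tors_max[OF i'] less by force
  next
    case False
    then have i': "i \<in> {r'+1..r}" using i by simp
    \<comment> \<open>Acting by \<open>m\<close> scales negative valuations by one common factor, so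
      the strict inequality persists; an integral \<open>z\<close> stays integral, while
      \<open>\<omega>0 i\<close> is not.\<close>
    have "w (\<omega>0 i) < w (act m z)"
    proof (cases "w z < 0")
      case True
      then obtain v where v: "w z = ereal v" "v < 0" using w_neg_real by blast
      obtain v' where v': "w (\<omega> i) = ereal v'" "v' < 0"
        using w_neg_real[OF less_trans[OF less True]] by blast
      have "v' < v" using less v v' by simp
      then show ?thesis
        using w_act_neg[OF v m(1)] w_act_neg[OF v' m(1)] root[OF i'] by simp
    next
      case False
      then have "0 \<le> w (act m z)" by (intro w_act_nonneg) simp
      then show ?thesis using SMB_neg[OF i'] by simp
    qed
    then obtain b where b: "act m z = (\<Sum>j=r'+1..i-1. act (b j) (\<omega>0 j))"
      using SMB_span[OF i' z] by blast
    let ?y = "z - (\<Sum>j=r'+1..i-1. act (b j) (\<omega> j))"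
    have "act m (\<Sum>j=r'+1..i-1. act (b j) (\<omega> j)) = (\<Sum>j=r'+1..i-1. act (b j) (act m (\<omega> j)))"
      unfolding act_sum_right by (simp only: act_commute[of m])
    also have "\<dots> = act m z"
      unfolding b using i by (intro sum.cong) (auto simp: root)
    finally have y: "act m ?y = 0"
      by (simp only: act_diff_right) simp
    \<comment> \<open>At the last index the independent family has full rank \<open>r'\<close> and
      therefore spans the torsion of \<open>\<psi>\<close>.\<close>
    have "r' \<in> {1..r'}" using rank_pos by simp
    then obtain c where c: "?y = (\<Sum>j=1..r'. act (c j) (\<omega> j))"
      using spanning_of_lin_indep_mod[OF m(1) tors_indep tors y] by blast
    \<comment> \<open>The relation expressing \<open>z\<close> by the earlier points; its
      coefficient 1 at \<open>i\<close> would have to be divisible by the non-unit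
      \<open>m\<close>.\<close>
    define a where "a = (\<lambda>j. if j = i then 1 else if j \<le> r' then - c j else - b j)"
    have split: "{1..i} = insert i ({1..r'} \<union> {r'+1..i-1})" using i' by auto
    have "(\<Sum>j=1..i. act (a j) (((\<omega>)(i := z)) j)) =
        z + ((\<Sum>j=1..r'. act (a j) (((\<omega>)(i := z)) j)) + (\<Sum>j=r'+1..i-1. act (a j) (((\<omega>)(i := z)) j)))"
      unfolding split using False i'
      by (subst sum.insert, simp, simp, subst sum.union_disjoint) (auto simp: a_def)
    also have "(\<Sum>j=1..r'. act (a j) (((\<omega>)(i := z)) j)) = - (\<Sum>j=1..r'. act (c j) (\<omega> j))"
      unfolding sum_negf[symmetric] using False
      by (intro sum.cong) (auto simp: a_def act_minus_left)
    also have "(\<Sum>j=r'+1..i-1. act (a j) (((\<omega>)(i := z)) j)) = - (\<Sum>j=r'+1..i-1. act (b j) (\<omega> j))"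
      unfolding sum_negf[symmetric] using i'
      by (intro sum.cong) (auto simp: a_def act_minus_left)
    also have "z + (- (\<Sum>j=1..r'. act (c j) (\<omega> j)) + - (\<Sum>j=r'+1..i-1. act (b j) (\<omega> j))) =
        ?y - (\<Sum>j=1..r'. act (c j) (\<omega> j))"
      by (simp add: algebra_simps)
    also have "\<dots> = 0"
      by (simp only: c diff_self)
    finally have "(\<Sum>j=1..i. act (a j) (((\<omega>)(i := z)) j)) = 0" .
    then have "m dvd a i" using dvd[of a i] i lattice_0 by simp
    then show False using m by (simp add: a_def)
  qed
qed

end

section \<open>Transfer from division points of \<open>\<Lambda>\<close> to the torsion of
  \<open>\<phi>\<close>\<close>

theorem theorem4p1:
  fixes h :: "'k::{field,finite} poly fract \<Rightarrow> 'c::alg_closed_field"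
    and w :: "'c \<Rightarrow> ereal"
    and F K \<Lambda> :: "'c set"
    and \<phi> \<psi> :: "'c poly"
    and e :: "'c \<Rightarrow> 'c"
    and u :: "'k poly"
    and r r' n :: nat
    and \<omega> \<omega>0 :: "nat \<Rightarrow> 'c"
  assumes "completion_at_finite_prime h w F K"
    and "drinfeld_module h K r \<phi>"
    and "stable_reduction CARD('k) w r \<phi> r'"
    and "1 \<le> r'" and "r' < r"
    and "tate_uniformization h w K r r' \<phi> \<psi> \<Lambda> e"
    and "lead_coeff u = 1" and "irreducible u"
    and "0 < n"
    and "torsion_SMB h w K r' \<psi> (u ^ n) \<omega>"
    and "lattice_SMB h w r' r \<psi> \<Lambda> \<omega>0"
    and "\<And>i. i \<in> {r'+1..r} \<Longrightarrow> poly (drinfeld_poly h \<psi> (u ^ n) - [:\<omega>0 i:]) (\<omega> i) = 0"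
  shows "torsion_SMB h w K r \<phi> (u ^ n) (\<lambda>i. e (\<omega> i))"
proof -
  let ?m = "u ^ n"
  have T: "drinfeld_module h K r' \<psi>" "good_reduction CARD('k) w r' \<psi>"
    "A_lattice h w \<psi> (r - r') \<Lambda>" "\<forall>\<mu>\<in>\<Lambda> - {0}. w \<mu> < 0"
    "\<forall>z. limitin (val_top w) (\<lambda>S. z * (\<Prod>\<mu>\<in>S. 1 - z / \<mu>)) (e z)
            (finite_subsets_at_top (\<Lambda> - {0}))"
    "surj e" "{z. e z = 0} = \<Lambda>"
    "\<forall>a z. e (drinfeld_act h \<psi> a z) = drinfeld_act h \<phi> a (e z)"
    using assms(6) unfolding tate_uniformization_def by - (elim conjE, assumption)+
  interpret C: completion_at_finite_prime h w F K by fact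
  have m: "?m \<noteq> 0" "\<not> ?m dvd 1"
    using assms(8,9) by (auto simp: irreducible_def is_unit_power_iff)
  have tors\<psi>: "torsion h K \<psi> ?m = {x. drinfeld_act h \<psi> ?m x = 0}"
    by (rule drinfeld_torsion_eq[OF assms(1) T(1) m(1)])
  have tors\<phi>: "torsion h K \<phi> ?m = {x. drinfeld_act h \<phi> ?m x = 0}"
    by (rule drinfeld_torsion_eq[OF assms(1,2) m(1)])
  interpret tate_torsion h w K r' \<psi> "r - r'" \<Lambda> e \<phi> r \<omega>0 ?m \<omega>
  proof unfold_locales
    show "is_field_hom h" "is_valuation w" "0 \<le> w (t_elem h)"
      by (fact C.hom C.valuation C.finite_prime)+
    show "?m \<noteq> 0" "\<not> ?m dvd 1" "lattice_SMB h w r' r \<psi> \<Lambda> \<omega>0"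
      by (fact m assms)+
    show "drinfeld_module h K r' \<psi>" "good_reduction CARD('k) w r' \<psi>"
      "A_lattice h w \<psi> (r - r') \<Lambda>" "{z. e z = 0} = \<Lambda>"
      by (fact T)+
    show "w \<mu> < 0" if "\<mu> \<in> \<Lambda> - {0}" for \<mu>
      using T(4) that by blast
    show "limitin (val_top w) (\<lambda>S. z * (\<Prod>\<mu>\<in>S. 1 - z / \<mu>)) (e z)
            (finite_subsets_at_top (\<Lambda> - {0}))" for z
      using T(5) by (rule spec)
    show "e (drinfeld_act h \<psi> a z) = drinfeld_act h \<phi> a (e z)" for a z
      using T(8) by simp
    show "drinfeld_act h \<psi> ?m (\<omega> i) = \<omega>0 i" if "i \<in> {r'+1..r}" for i
      using assms(12)[OF that] by simp
    fix i assume i: "i \<in> {1..r'}"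
    show "drinfeld_act h \<psi> ?m (\<omega> i) = 0" "lin_indep_mod h \<psi> ?m {1..i} \<omega>"
      using assms(10) i tors\<psi> unfolding torsion_SMB_def by blast+
    show "w y \<le> w (\<omega> i)"
      if "drinfeld_act h \<psi> ?m y = 0" "lin_indep_mod h \<psi> ?m {1..i} ((\<omega>)(i := y))" for y
      using assms(10) i tors\<psi> that unfolding torsion_SMB_def by blast
  qed
  show ?thesis
    unfolding torsion_SMB_def
  proof (intro ballI conjI impI)
    fix i assume i: "i \<in> {1..r}"
    have "drinfeld_act h \<phi> ?m (e (\<omega> i)) = 0"
      using act_omega_in[OF i] by (simp flip: e_act add: e_eq_0_iff)
    then show "e (\<omega> i) \<in> torsion h K \<phi> ?m"
      by (simp add: tors\<phi>)
    show "lin_indep_mod h \<phi> ?m {1..i} (\<lambda>i. e (\<omega> i))"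
      by (rule lin_indep_e_omega[OF i])
    fix y assume y: "y \<in> torsion h K \<phi> ?m"
      and ind: "lin_indep_mod h \<phi> ?m {1..i} ((\<lambda>i. e (\<omega> i))(i := y))"
    obtain z0 where z0: "y = e z0" using T(6) by (metis surjD)
    \<comment> \<open>The preimage is moved within its coset, which keeps its image
      \<open>y\<close>, to meet the maximality condition that \<open>w_e_mono\<close> puts on its
      left-hand point.\<close>
    obtain l where l: "l \<in> \<Lambda>" and max: "\<forall>\<mu>\<in>\<Lambda>. w (z0 - l - \<mu>) \<le> w (z0 - l)"
      using ex_coset_max by blast
    have ez: "e (z0 - l) = y" using z0 e_minus_lattice[OF l] by simp
    have "e (act ?m (z0 - l)) = 0"
      using y by (simp add: e_act ez tors\<phi>)
    then have "act ?m (z0 - l) \<in> \<Lambda>" by (simp only: e_eq_0_iff)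
    then have "w (z0 - l) \<le> w (\<omega> i)"
      using w_le_of_lin_indep_e[OF i] ind ez by blast
    then have "w (e (z0 - l)) \<le> w (e (\<omega> i))"
      using max by (intro w_e_mono) auto
    then show "w y \<le> w (e (\<omega> i))" by (simp only: ez)
  qed
qed

end
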